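(* Let $m,u\in A=\mathbb{F}_q[T]$ be monic polynomials with $\deg(m)>0$. Assume that if $\deg(u)=0$ or $\deg(u)=1$, then $q>2$. Let $\wp$ be a monic prime dividing $\Psi_m(u)$, and let $P_{u,\wp}$ be the Carlitz annihilator of $(u,\wp)$. Then: (i) $\wp$ is a non-Zsigmondy prime for $(u,m)$ if and only if $\wp$ divides $m$; (ii) if $\wp$ is a non-Zsigmondy prime for $(u,m)$, then $m=P_{u,\wp}\wp^s$ for some positive integer $s$; furthermore $\wp^2$ does not divide $\Psi_m(u)$ unless $q=2$ and $\deg(\wp)=1$.
   Context: $A=\mathbb{F}_q[T]$, $k=\mathbb{F}_q(T)$, $\bar k$ an algebraic closure. The Carlitz module is the $\mathbb{F}_q$-algebra homomorphism $a\mapsto C_a$ from $A$ to the twisted polynomial ring $k\langle\tau\rangle$ ($\tau(x)=x^q$) with $C_T=T+\tau$; so $C_a(x)\in A[x]$ and $C_{ab}(x)=C_a(C_b(x))$. For $m$ of positive degree, $\Lambda_m=\{\lambda\in\bar k: C_m(\lambda)=0\}$ is an $A$-module via $C$; a primitive $m$-th root of $C$ is an element generating $\Lambda_m$ as an $A$-module, and the $m$-th cyclotomic polynomial $\Psi_m(x)$ is the minimal polynomial over $k$ of a primitive $m$-th root of $C$ (it lies in $A[x]$). For nonzero $u\in A$ and a monic prime $\wp$: if $\wp\nmid u$, the Carlitz annihilator $P_{u,\wp}$ is the unique monic polynomial of positive degree such that for every nonzero $n\in A$, $P_{u,\wp}\mid n$ iff $C_n(u)\equiv0\pmod\wp$;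 if $\wp\mid u$, $P_{u,\wp}=1$. For nonzero $m,u\in A$, a Zsigmondy prime for $(u,m)$ is a monic prime $\wp$ with $C_m(u)\equiv 0\pmod{\wp}$ and $C_n(u)\not\equiv 0\pmod{\wp}$ for every nonzero $n\in A$ with $\deg(n)<\deg(m)$; a monic prime that is not a Zsigmondy prime for $(u,m)$ is called a non-Zsigmondy prime for $(u,m)$. *)

theory Defs
  imports
    "HOL-Algebra.Algebraic_Closure_Type"
    "HOL-Computational_Algebra.Computational_Algebra"
    "HOL-Library.Cardinality"
begin

text \<open>
  Throughout, \<open>'a\<close> is the finite field with \<open>q = CARD('a)\<close> elements, \<open>'a poly\<close> is
  \<open>A = F\<^sub>q[T]\<close>, \<open>'a poly fract\<close> is \<open>k = F\<^sub>q(T)\<close>, and \<open>'a poly fract alg_closure\<close> is the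
  algebraic closure of \<open>k\<close>. Polynomials in \<open>x\<close> over \<open>A\<close> have type \<open>'a poly poly\<close>.
\<close>

section \<open>The Carlitz module\<close>

text \<open>
  A twisted polynomial \<open>\<Sum>c\<^sub>i \<tau>\<^sup>i\<close> is identified with the \<open>q\<close>-linear polynomial
  \<open>\<Sum>c\<^sub>i x^(q^i)\<close>, so that multiplication of twisted polynomials becomes composition.
  Then \<open>T + \<tau>\<close> is \<open>T x + x^q\<close>, and the \<open>F\<^sub>q\<close>-algebra homomorphism determined by
  \<open>T \<mapsto> T + \<tau>\<close> sends \<open>a = \<Sum>a\<^sub>i T\<^sup>i\<close> to the sum of the \<open>i\<close>-fold self-compositions of
  \<open>T x + x^q\<close> (applied to \<open>x\<close>), weighted by \<open>a\<^sub>i\<close>. The lemmas below, up to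
  \<open>carlitz_unique\<close>, confirm that this is a homomorphism and that it is the only one.
\<close>

definition carlitz_T :: "'a::finite_field poly poly" where
  "carlitz_T = smult [:0, 1:] [:0, 1:] + [:0, 1:] ^ CARD('a)"

definition carlitz :: "'a::finite_field poly \<Rightarrow> 'a poly poly" where
  "carlitz a = (\<Sum>i\<le>degree a. smult [:coeff a i:] ((pcompose carlitz_T ^^ i) [:0, 1:]))"

lemma carlitz_altdef:
  assumes "degree a < n"
  shows "carlitz a = (\<Sum>i<n. smult [:coeff a i:] ((pcompose carlitz_T ^^ i) [:0, 1:]))"
  unfolding carlitz_def
  by (rule sum.mono_neutral_left) (use assms in \<open>auto intro: coeff_eq_0\<close>)

lemma carlitz_add: "carlitz (a + b) = carlitz a + carlitz b"
proof -
  define n where "n = Suc (max (degree a) (degree b))"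
  have "degree a < n" "degree b < n" "degree (a + b) < n"
    using degree_add_le_max[of a b] by (auto simp: n_def)
  then show ?thesis
    by (simp add: carlitz_altdef[of _ n] sum.distrib[symmetric] flip: smult_add_left)
qed

lemma smult_sum_right: "smult c (\<Sum>i\<in>I. f i) = (\<Sum>i\<in>I. smult c (f i))"
  by (induction I rule: infinite_finite_induct) (simp_all add: smult_add_right)

lemma carlitz_smult: "carlitz (smult c a) = smult [:c:] (carlitz a)"
proof -
  have "degree (smult c a) < Suc (degree a)" "degree a < Suc (degree a)"
    by (auto simp: less_Suc_eq_le)
  then have "carlitz (smult c a) =
      (\<Sum>i<Suc (degree a). smult [:c * coeff a i:] ((pcompose carlitz_T ^^ i) [:0, 1:]))"
    by (simp add: carlitz_altdef[of _ "Suc (degree a)"] del: sum.lessThan_Suc)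
  also have "\<dots> = smult [:c:] (\<Sum>i<Suc (degree a).
      smult [:coeff a i:] ((pcompose carlitz_T ^^ i) [:0, 1:]))"
    by (simp add: smult_sum_right mult.commute del: sum.lessThan_Suc)
  finally show ?thesis
    by (simp add: carlitz_altdef[of a "Suc (degree a)"] del: sum.lessThan_Suc)
qed

lemma carlitz_const: "carlitz [:c:] = smult [:c:] [:0, 1:]"
  by (simp add: carlitz_def)

lemma carlitz_gen: "carlitz [:0, 1:] = carlitz_T"
proof -
  have "smult [:1:] f = f" for f :: "'a poly poly"
    by (simp flip: one_pCons)
  then show ?thesis
    by (simp add: carlitz_def)
qed

lemma of_nat_choose_card_eq_0:
  assumes "0 < i" "i < CARD('a)"
  shows "of_nat (CARD('a) choose i) = (0 :: 'a::finite_field)"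
proof -
  define P :: "'a poly" where "P = [:1, 1:] ^ CARD('a) - monom 1 CARD('a) - 1"
  have c: "coeff ([:1, 1:] ^ n :: 'a poly) j = of_nat (n choose j)" for n j
  proof -
    have "[:1, 1:] ^ n = (monom 1 1 + 1 :: 'a poly) ^ n"
      by (simp add: monom_altdef one_pCons)
    also have "\<dots> = (\<Sum>k\<le>n. monom (of_nat (n choose k)) k)"
      by (subst binomial_ring) (simp add: monom_power of_nat_monom mult_monom)
    finally show ?thesis
      by (simp add: coeff_sum coeff_monom binomial_eq_0)
  qed
  have 0: "coeff P j = 0" if "j \<ge> CARD('a)" for j
    using that by (cases "j = CARD('a)") (auto simp: P_def c coeff_monom coeff_1 binomial_eq_0)
  have roots: "poly P x = 0" for x
    by (simp add: P_def poly_monom finite_field_power_card_eq_same)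
  have "P = 0"
  proof (rule ccontr)
    assume nz: "P \<noteq> 0"
    then have "degree P < CARD('a)"
      using 0 leading_coeff_0_iff not_less by blast
    moreover have "{x. poly P x = 0} = UNIV"
      using roots by auto
    then have "CARD('a) \<le> degree P"
      using card_poly_roots_bound[OF nz] by simp
    ultimately show False by simp
  qed
  then have "coeff P i = 0" by simp
  then show ?thesis
    using assms by (simp add: P_def c coeff_monom coeff_1)
qed

lemma frobenius_add:
  fixes f g :: "'a::finite_field poly poly"
  shows "(f + g) ^ CARD('a) = f ^ CARD('a) + g ^ CARD('a)"
proof -
  let ?q = "CARD('a)"
  have "(f + g) ^ ?q = (\<Sum>k\<le>?q. of_nat (?q choose k) * f ^ k * g ^ (?q - k))"
    by (rule binomial_ring)
  also have "\<dots> = (\<Sum>k\<in>{0, ?q}. of_nat (?q choose k) * f ^ k * g ^ (?q - k))"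
  proof (rule sum.mono_neutral_right, simp, simp, rule ballI)
    fix k assume "k \<in> {..?q} - {0, ?q}"
    then have "of_nat (?q choose k) = (0 :: 'a)"
      by (intro of_nat_choose_card_eq_0) auto
    then have "of_nat (?q choose k) = (0 :: 'a poly poly)"
      by (simp add: of_nat_poly)
    then show "of_nat (?q choose k) * f ^ k * g ^ (?q - k) = 0"
      by simp
  qed
  finally show ?thesis
    by simp
qed

lemma pcompose_power: "pcompose (p ^ n) q = pcompose p q ^ n"
  for p q :: "'b::comm_ring_1 poly"
  by (induction n) (simp_all add: pcompose_mult pcompose_1)

lemma pcompose_carlitz_T: "pcompose carlitz_T f = smult [:0, 1:] f + f ^ CARD('a)"
  for f :: "'a::finite_field poly poly"
  unfolding carlitz_T_def pcompose_add pcompose_smult pcompose_power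
  by (simp add: pcompose_pCons)

lemma carlitz_T_add: "pcompose carlitz_T (f + g) = pcompose carlitz_T f + pcompose carlitz_T g"
  for f g :: "'a::finite_field poly poly"
  by (simp add: pcompose_carlitz_T frobenius_add smult_add_right)

lemma carlitz_T_smult: "pcompose carlitz_T (smult [:c:] f) = smult [:c:] (pcompose carlitz_T f)"
  for f :: "'a::finite_field poly poly"
proof -
  have "[:c:] ^ CARD('a) = [:c:]"
    by (simp add: poly_const_pow finite_field_power_card_eq_same)
  then show ?thesis
    by (simp add: pcompose_carlitz_T smult_power smult_add_right mult.commute)
qed

lemma carlitz_T_sum: "pcompose carlitz_T (\<Sum>i\<in>I. f i) = (\<Sum>i\<in>I. pcompose carlitz_T (f i))"
  for f :: "'b \<Rightarrow> 'a::finite_field poly poly"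
  by (induction I rule: infinite_finite_induct) (simp_all add: carlitz_T_add, simp_all add: pcompose_carlitz_T)

lemma carlitz_pCons: "carlitz (pCons c a) = smult [:c:] [:0, 1:] + pcompose carlitz_T (carlitz a)"
proof -
  define n where "n = Suc (degree a)"
  have "degree a < n" "degree (pCons c a) < Suc n"
    by (auto simp: n_def degree_pCons_le less_Suc_eq_le)
  then show ?thesis
    by (simp add: carlitz_altdef[of _ n] carlitz_altdef[of _ "Suc n"] carlitz_T_sum carlitz_T_smult
        sum.lessThan_Suc_shift del: sum.lessThan_Suc)
qed

lemma carlitz_0 [simp]: "carlitz 0 = 0"
  by (simp add: carlitz_def)

lemma carlitz_mult: "carlitz (a * b) = pcompose (carlitz a) (carlitz b)"
proof (induction a)
  case (pCons c a)
  have "carlitz (pCons c a * b) = smult [:c:] (carlitz b) + pcompose carlitz_T (carlitz (a * b))"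
    by (simp add: carlitz_add carlitz_smult carlitz_pCons)
  then show ?case
    by (simp add: pCons.IH carlitz_pCons pcompose_add pcompose_smult pcompose_assoc pcompose_pCons)
qed simp

lemma carlitz_unique:
  fixes \<phi> :: "'a::finite_field poly \<Rightarrow> 'a poly poly"
  assumes "\<And>a b. \<phi> (a + b) = \<phi> a + \<phi> b"
    and "\<And>a b. \<phi> (a * b) = pcompose (\<phi> a) (\<phi> b)"
    and "\<And>c. \<phi> [:c:] = smult [:c:] [:0, 1:]"
    and "\<phi> [:0, 1:] = carlitz_T"
  shows "\<phi> = carlitz"
proof
  fix a
  show "\<phi> a = carlitz a"
  proof (induction a)
    case 0
    show ?case using assms(3)[of 0] by simp
  next
    case (pCons c a)
    have "pCons c a = [:c:] + [:0, 1:] * a"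
      by simp
    then have "\<phi> (pCons c a) = smult [:c:] [:0, 1:] + pcompose carlitz_T (\<phi> a)"
      by (simp only: assms)
    then show ?case
      by (simp add: pCons.IH carlitz_pCons)
  qed
qed

section \<open>Torsion and cyclotomic polynomials\<close>

definition carlitz_act ::
    "'a::finite_field poly \<Rightarrow> 'a poly fract alg_closure \<Rightarrow> 'a poly fract alg_closure" where
  "carlitz_act a x = poly (map_poly (\<lambda>c. to_ac (to_fract c)) (carlitz a)) x"

definition carlitz_torsion :: "'a::finite_field poly \<Rightarrow> 'a poly fract alg_closure set" where
  "carlitz_torsion m = {x. carlitz_act m x = 0}"

text \<open>The \<open>A\<close>-submodule generated by \<open>x\<close> consists of the values \<open>C\<^sub>a(x)\<close>, \<open>a \<in> A\<close>.\<close>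

definition primitive_carlitz_root ::
    "'a::finite_field poly \<Rightarrow> 'a poly fract alg_closure \<Rightarrow> bool" where
  "primitive_carlitz_root m x \<longleftrightarrow> x \<in> carlitz_torsion m \<and> carlitz_torsion m = range (\<lambda>a. carlitz_act a x)"

definition is_min_poly :: "'b::field alg_closure \<Rightarrow> 'b poly \<Rightarrow> bool" where
  "is_min_poly x p \<longleftrightarrow> lead_coeff p = 1 \<and> poly (map_poly to_ac p) x = 0 \<and>
     (\<forall>r. r \<noteq> 0 \<and> poly (map_poly to_ac r) x = 0 \<longrightarrow> degree p \<le> degree r)"

definition min_poly :: "'b::field alg_closure \<Rightarrow> 'b poly" where
  "min_poly x = (THE p. is_min_poly x p)"

lemma is_min_poly_min_poly: "is_min_poly x (min_poly x)"
  unfolding min_poly_def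
proof (rule theI')
  let ?R = "\<lambda>p. p \<noteq> 0 \<and> poly (map_poly to_ac p) x = 0"
  obtain p0 where "?R p0"
    using alg_closure_algebraic[of x] by blast
  then obtain p where p: "?R p" "\<And>r. ?R r \<Longrightarrow> degree p \<le> degree r"
    using ex_has_least_nat[of ?R p0 degree] by blast
  have smult: "map_poly to_ac (smult c r) = smult (to_ac c) (map_poly to_ac r)" for c r
    by (intro poly_eqI) (simp add: coeff_map_poly)
  have diff: "map_poly to_ac (r - s) = map_poly to_ac r - map_poly to_ac s" for r s
    by (intro poly_eqI) (simp add: coeff_map_poly)
  let ?p = "smult (inverse (lead_coeff p)) p"
  have "is_min_poly x ?p"
    using p by (auto simp: is_min_poly_def smult)
  moreover have "r = s" if r: "is_min_poly x r" and s: "is_min_poly x s" for r s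
  proof (rule ccontr)
    assume ne: "r \<noteq> s"
    have nz: "r \<noteq> 0" "s \<noteq> 0"
      using r s by (auto simp: is_min_poly_def)
    then have deg: "degree r = degree s"
      using r s by (intro antisym) (auto simp: is_min_poly_def)
    have "?R (r - s)"
      using r s ne by (auto simp: is_min_poly_def diff)
    then have le: "degree r \<le> degree (r - s)"
      using r by (auto simp: is_min_poly_def)
    moreover have "degree (r - s) \<le> degree r"
      using degree_diff_le_max[of r s] deg by simp
    ultimately have "lead_coeff (r - s) = 0"
      using r s deg by (simp add: is_min_poly_def)
    then show False
      using ne leading_coeff_0_iff[of "r - s"] by (metis right_minus_eq)
  qed
  ultimately show "\<exists>!p. is_min_poly x p"
    by blast
qed

text \<open>
  All primitive \<open>m\<close>-th roots are conjugate over \<open>k\<close>, so the choice made here does not matter. The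
  minimal polynomial has coefficients in \<open>A\<close>, and the cyclotomic polynomial is taken as a
  polynomial over \<open>A\<close>.
\<close>

definition carlitz_cyclotomic :: "'a::finite_field poly \<Rightarrow> 'a poly poly" where
  "carlitz_cyclotomic m =
     (THE \<Psi>. map_poly to_fract \<Psi> = min_poly (SOME x. primitive_carlitz_root m x))"

section \<open>Carlitz annihilators and Zsigmondy primes\<close>

definition monic_prime :: "'a::field poly \<Rightarrow> bool" where
  "monic_prime w \<longleftrightarrow> lead_coeff w = 1 \<and> prime_elem w"

definition carlitz_annihilator :: "'a::finite_field poly \<Rightarrow> 'a poly \<Rightarrow> 'a poly" where
  "carlitz_annihilator u w =
     (if w dvd u then 1
      else (THE P. lead_coeff P = 1 \<and> degree P > 0 \<and>
              (\<forall>n. n \<noteq> 0 \<longrightarrow> (P dvd n \<longleftrightarrow> w dvd poly (carlitz n) u))))"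

definition zsigmondy_prime :: "'a::finite_field poly \<Rightarrow> 'a poly \<Rightarrow> 'a poly \<Rightarrow> bool" where
  "zsigmondy_prime u m w \<longleftrightarrow> monic_prime w \<and> w dvd poly (carlitz m) u \<and>
     (\<forall>n. n \<noteq> 0 \<and> degree n < degree m \<longrightarrow> \<not> w dvd poly (carlitz n) u)"

definition non_zsigmondy_prime :: "'a::finite_field poly \<Rightarrow> 'a poly \<Rightarrow> 'a poly \<Rightarrow> bool" where
  "non_zsigmondy_prime u m w \<longleftrightarrow> monic_prime w \<and> \<not> zsigmondy_prime u m w"

end

theory Submission
  imports Defs
begin

text \<open>
  Write \<open>C\<^sub>k(y) = y R\<^sub>k(y)\<close>, so that \<open>R\<^sub>k(0) = k\<close>. If \<open>m = k n\<close> with \<open>k\<close> nonconstant, then a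
  primitive \<open>m\<close>-th root \<open>\<lambda>\<close> satisfies \<open>C\<^sub>n(\<lambda>) \<noteq> 0\<close> and \<open>C\<^sub>k(C\<^sub>n(\<lambda>)) = 0\<close>, hence
  \<open>\<Psi>\<^sub>m(x)\<close> divides \<open>R\<^sub>k(C\<^sub>n(x))\<close> in \<open>A[x]\<close>. Consequently, if a prime \<open>w\<close> divides both
  \<open>\<Psi>\<^sub>m(u)\<close> and \<open>C\<^sub>n(u)\<close>, then it divides \<open>k\<close>. Let \<open>P\<close> generate the ideal of all \<open>n\<close> with
  \<open>C\<^sub>n(u) \<equiv> 0\<close> modulo \<open>w\<close>. If \<open>w\<close> is non-Zsigmondy, then \<open>P\<close> is a proper divisor of \<open>m\<close>, so
  \<open>w\<close> divides \<open>m / P\<close>. Conversely write \<open>m = k w\<^sup>s\<close> with \<open>k\<close> prime to \<open>w\<close>. As \<open>C\<^sub>w\<close> is a power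
  of \<open>x\<close> modulo \<open>w\<close>, also \<open>C\<^sub>k(u) \<equiv> 0\<close>, and the divisibility above with cofactor \<open>k / P\<close>
  forces \<open>P = k\<close>. Finally \<open>R\<^sub>w(y) \<equiv> w\<close> modulo \<open>w\<^sup>2\<close> whenever \<open>w\<close> divides \<open>y\<close>, except when
  \<open>q = 2\<close> and \<open>w\<close> is linear, which excludes \<open>w\<^sup>2\<close> as a divisor of \<open>\<Psi>\<^sub>m(u)\<close>.
\<close>

section \<open>Coefficients of Carlitz polynomials\<close>

lemma card_field_ge_2: "CARD('a::finite_field) \<ge> 2"
proof -
  have "card {0, 1 :: 'a} \<le> CARD('a)" by (rule card_mono) auto
  then show ?thesis by simp
qed

text \<open>The vanishing of the binomials is a hypothesis so that one expansion serves both in A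
  and in the algebraic closure of its fraction field.\<close>

lemma power_card_field_add:
  fixes x y :: "'b::comm_ring_1"
  assumes "\<And>i. 0 < i \<Longrightarrow> i < CARD('a) \<Longrightarrow> of_nat (CARD('a::finite_field) choose i) = (0 :: 'b)"
  shows "(x + y) ^ CARD('a) = x ^ CARD('a) + y ^ CARD('a)"
proof -
  let ?q = "CARD('a)"
  have "(x + y) ^ ?q = (\<Sum>k\<le>?q. of_nat (?q choose k) * x ^ k * y ^ (?q - k))"
    by (rule binomial_ring)
  also have "\<dots> = (\<Sum>k\<in>{0, ?q}. of_nat (?q choose k) * x ^ k * y ^ (?q - k))"
    by (rule sum.mono_neutral_right) (auto simp: assms)
  finally show ?thesis by simp
qed

lemma poly_power_card_add:
  fixes x y :: "'a::finite_field poly"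
  shows "(x + y) ^ CARD('a) = x ^ CARD('a) + y ^ CARD('a)"
  by (rule power_card_field_add) (simp add: of_nat_poly of_nat_choose_card_eq_0)

lemma poly_power_card_power_add:
  fixes x y :: "'a::finite_field poly"
  shows "(x + y) ^ (CARD('a) ^ j) = x ^ (CARD('a) ^ j) + y ^ (CARD('a) ^ j)"
proof (induction j)
  case (Suc j)
  have "(x + y) ^ CARD('a) ^ Suc j = ((x + y) ^ CARD('a) ^ j) ^ CARD('a)"
    by (simp add: mult.commute flip: power_mult)
  also have "\<dots> = (x ^ CARD('a) ^ j) ^ CARD('a) + (y ^ CARD('a) ^ j) ^ CARD('a)"
    by (simp add: Suc.IH poly_power_card_add)
  finally show ?case
    by (simp add: mult.commute flip: power_mult)
qed simp

lemma frobenius_sum: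
  fixes f :: "'b \<Rightarrow> 'a::finite_field poly poly"
  shows "(\<Sum>i\<in>I. f i) ^ CARD('a) = (\<Sum>i\<in>I. f i ^ CARD('a))"
  by (induction I rule: infinite_finite_induct) (simp_all add: frobenius_add)

lemma sum_monom_frobenius:
  fixes g :: "nat \<Rightarrow> 'a::finite_field poly"
  shows "(\<Sum>i\<le>n. monom (g i) (CARD('a) ^ i)) ^ CARD('a)
     = (\<Sum>i\<le>n. monom (g i ^ CARD('a)) (CARD('a) ^ Suc i))"
  by (simp add: frobenius_sum monom_power mult.commute)

section \<open>Carlitz polynomials as sums over the exponents q^i\<close>

lemma carlitz_form_exists:
  fixes a :: "'a::finite_field poly"
  shows "\<exists>g. carlitz a = (\<Sum>i\<le>degree a. monom (g i) (CARD('a) ^ i)) \<and>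
     g 0 = a \<and> g (degree a) = [:lead_coeff a:] \<and> (\<forall>i>degree a. g i = 0)"
proof (induction a)
  case 0
  show ?case by (rule exI[of _ "\<lambda>_. 0"]) simp
next
  case (pCons c a)
  let ?q = "CARD('a)"
  show ?case
  proof (cases "a = 0")
    case True
    then show ?thesis
      by (intro exI[of _ "\<lambda>i. if i = 0 then [:c:] else 0"])
         (auto simp: carlitz_const monom_altdef)
  next
    case False
    obtain g where g: "carlitz a = (\<Sum>i\<le>degree a. monom (g i) (?q ^ i))"
      "g 0 = a" "g (degree a) = [:lead_coeff a:]" "\<And>i. i > degree a \<Longrightarrow> g i = 0"
      using pCons.IH by blast
    define n where "n = degree a"
    \<comment> \<open>Read off from C_{c+Ta} = c x + T C_a + C_a^q: the q-th power moves the
      coefficient at q^i to q^(i+1), and the linear coefficient becomes c + Ta.\<close>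
    define h where "h = case_nat (pCons c a) (\<lambda>i. [:0, 1:] * g (Suc i) + g i ^ ?q)"
    have "carlitz (pCons c a) = smult [:c:] [:0, 1:] + smult [:0, 1:] (carlitz a) + carlitz a ^ ?q"
      by (simp add: carlitz_pCons pcompose_carlitz_T)
    also have "carlitz a ^ ?q = (\<Sum>i\<le>n. monom (g i ^ ?q) (?q ^ Suc i))"
      unfolding g(1) n_def by (rule sum_monom_frobenius)
    \<comment> \<open>The added term at \<open>Suc n\<close> is zero; it aligns this sum with the
      shifted one.\<close>
    also have "smult [:0, 1:] (carlitz a) = (\<Sum>i\<le>Suc n. monom ([:0, 1:] * g i) (?q ^ i))"
      unfolding g(1) n_def by (simp add: smult_sum_right smult_monom g(4))
    also have "\<dots> = monom ([:0,1:] * a) 1 + (\<Sum>i\<le>n. monom ([:0, 1:] * g (Suc i)) (?q ^ Suc i))"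
      by (subst sum.atMost_Suc_shift) (simp add: g(2))
    also have "smult [:c:] [:0, 1:] = monom [:c:] (1::nat)"
      by (simp add: monom_altdef)
    finally have "carlitz (pCons c a) = monom (h 0) 1 + (\<Sum>i\<le>n. monom (h (Suc i)) (?q ^ Suc i))"
      by (simp add: h_def sum.distrib add_monom flip: add_monom) (simp add: add_monom)
    also have "\<dots> = (\<Sum>i\<le>Suc n. monom (h i) (?q ^ i))"
      by (subst sum.atMost_Suc_shift) simp
    finally have 1: "carlitz (pCons c a) = (\<Sum>i\<le>Suc n. monom (h i) (?q ^ i))" .
    have "[:lead_coeff a:] ^ ?q = [:lead_coeff a:]"
      by (simp add: poly_const_pow finite_field_power_card_eq_same)
    then have 2: "h (Suc n) = [:lead_coeff a:]"
      using g(3,4) by (simp add: h_def n_def)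
    have 3: "h i = 0" if "i > Suc n" for i
      using that g(4) card_field_ge_2[where 'a = 'a] by (auto simp: h_def n_def split: nat.split)
    show ?thesis
      using 1 2 3 False by (intro exI[of _ h]) (simp add: n_def h_def)
  qed
qed

text \<open>This is the coefficient of tau^i when \<open>carlitz a\<close> is read as a twisted
  polynomial.\<close>

definition carlitz_coeff :: "'a::finite_field poly \<Rightarrow> nat \<Rightarrow> 'a poly" where
  "carlitz_coeff a i = coeff (carlitz a) (CARD('a) ^ i)"

lemma coeff_sum_monom_power:
  fixes g :: "nat \<Rightarrow> 'b::comm_monoid_add"
  assumes "q \<ge> 2"
  shows "coeff (\<Sum>i\<le>n. monom (g i) (q ^ i)) (q ^ j) = (if j \<le> n then g j else 0)"
  using assms by (simp add: coeff_sum coeff_monom)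

lemma carlitz_form:
  "carlitz a = (\<Sum>i\<le>degree a. monom (carlitz_coeff a i) (CARD('a) ^ i))"
  and carlitz_coeff_0: "carlitz_coeff a 0 = a"
  and carlitz_coeff_degree: "carlitz_coeff a (degree a) = [:lead_coeff a:]"
  for a :: "'a::finite_field poly"
proof -
  obtain g where g: "carlitz a = (\<Sum>i\<le>degree a. monom (g i) (CARD('a) ^ i))"
      "g 0 = a" "g (degree a) = [:lead_coeff a:]" "\<And>i. i > degree a \<Longrightarrow> g i = 0"
    using carlitz_form_exists by blast
  have "carlitz_coeff a i = g i" for i
    unfolding carlitz_coeff_def g(1)
    using g(4) by (simp add: coeff_sum_monom_power card_field_ge_2)
  then have "carlitz_coeff a = g" by auto
  then show "carlitz a = (\<Sum>i\<le>degree a. monom (carlitz_coeff a i) (CARD('a) ^ i))"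
    "carlitz_coeff a 0 = a" "carlitz_coeff a (degree a) = [:lead_coeff a:]"
    using g by simp_all
qed

lemma carlitz_coeff_eq_0: "i > degree a \<Longrightarrow> carlitz_coeff a i = 0"
  unfolding carlitz_coeff_def
  by (subst carlitz_form) (simp add: coeff_sum_monom_power card_field_ge_2)

lemma coeff_carlitz_eq_0:
  fixes a :: "'a::finite_field poly"
  assumes "\<And>i. n \<noteq> CARD('a) ^ i"
  shows "coeff (carlitz a) n = 0"
  by (subst carlitz_form) (simp add: coeff_sum coeff_monom assms[symmetric])

lemma degree_carlitz:
  fixes a :: "'a::finite_field poly"
  assumes "a \<noteq> 0"
  shows "degree (carlitz a) = CARD('a) ^ degree a"
proof (rule antisym)
  show "degree (carlitz a) \<le> CARD('a) ^ degree a"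
    by (subst carlitz_form, rule degree_sum_le)
       (auto intro!: order.trans[OF degree_monom_le] power_increasing)
  show "CARD('a) ^ degree a \<le> degree (carlitz a)"
    using carlitz_coeff_degree[of a] assms by (intro le_degree) (simp add: carlitz_coeff_def)
qed

lemma lead_coeff_carlitz: "lead_coeff (carlitz a) = [:lead_coeff a:]"
  for a :: "'a::finite_field poly"
  by (cases "a = 0") (simp_all add: degree_carlitz carlitz_coeff_degree flip: carlitz_coeff_def)

lemma coeff_carlitz_0 [simp]: "coeff (carlitz a) 0 = 0"
  by (rule coeff_carlitz_eq_0) simp

lemma carlitz_1: "carlitz 1 = [:0, 1:]"
  by (simp add: one_pCons carlitz_const)

text \<open>Comparing coefficients in \<open>C\<^sub>a C\<^sub>T = C\<^sub>T C\<^sub>a\<close>.\<close>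

lemma carlitz_coeff_Suc:
  fixes a :: "'a::finite_field poly"
  shows "([:0, 1:] ^ (CARD('a) ^ Suc j) - [:0, 1:]) * carlitz_coeff a (Suc j)
     = carlitz_coeff a j ^ CARD('a) - carlitz_coeff a j"
proof -
  let ?q = "CARD('a)" and ?g = "carlitz_coeff a" and ?T = "[:0, 1 :: 'a:]"
  \<comment> \<open>Additivity of the q-power map leaves just two terms at every iteration.\<close>
  have pow: "carlitz_T ^ (?q ^ i) = monom (?T ^ (?q ^ i)) (?q ^ i) + monom 1 (?q ^ Suc i)" for i
  proof (induction i)
    case 0
    show ?case by (simp add: carlitz_T_def monom_altdef)
  next
    case (Suc i)
    have "carlitz_T ^ (?q ^ Suc i) = (carlitz_T ^ (?q ^ i)) ^ ?q"
      by (simp add: mult.commute flip: power_mult)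
    also have "\<dots> = monom (?T ^ (?q ^ i)) (?q ^ i) ^ ?q + monom 1 (?q ^ Suc i) ^ ?q"
      unfolding Suc.IH by (rule frobenius_add)
    finally show ?case
      by (simp add: monom_power mult_ac flip: power_mult)
  qed
  \<comment> \<open>Padding by zero coefficients puts the index \<open>Suc j\<close> in range even
    beyond the degree of \<open>a\<close>.\<close>
  define n where "n = max (degree a) (Suc j)"
  have form: "carlitz a = (\<Sum>i\<le>n. monom (?g i) (?q ^ i))"
    by (subst carlitz_form, rule sum.mono_neutral_left) (auto simp: n_def carlitz_coeff_eq_0)
  have "pcompose (carlitz a) carlitz_T = carlitz (a * ?T)"
    by (simp only: carlitz_mult carlitz_gen)
  also have "\<dots> = pcompose carlitz_T (carlitz a)"
    by (simp only: mult.commute[of a] carlitz_mult carlitz_gen)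
  also have "\<dots> = smult ?T (carlitz a) + carlitz a ^ ?q"
    by (rule pcompose_carlitz_T)
  finally have eq: "pcompose (carlitz a) carlitz_T = smult ?T (carlitz a) + carlitz a ^ ?q" .
  have shift: "coeff (\<Sum>i\<le>n. monom (f i) (?q ^ Suc i)) (?q ^ Suc j) = f j"
    for f :: "nat \<Rightarrow> 'a poly"
  proof -
    have "coeff (\<Sum>i\<le>n. monom (f i) (?q ^ Suc i)) (?q ^ Suc j) = (\<Sum>i\<le>n. if i = j then f i else 0)"
      unfolding coeff_sum coeff_monom
      by (rule sum.cong) (use card_field_ge_2[where 'a = 'a] in \<open>auto simp del: power_Suc\<close>)
    then show ?thesis by (simp add: n_def)
  qed
  have "pcompose (carlitz a) carlitz_T
      = (\<Sum>i\<le>n. smult (?g i) (carlitz_T ^ (?q ^ i)))"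
    unfolding form by (simp add: pcompose_sum monom_altdef pcompose_smult pcompose_power pcompose_pCons)
  also have "\<dots> = (\<Sum>i\<le>n. monom (?g i * ?T ^ (?q ^ i)) (?q ^ i)) + (\<Sum>i\<le>n. monom (?g i) (?q ^ Suc i))"
    by (simp add: pow smult_add_right smult_monom sum.distrib)
  finally have "coeff (pcompose (carlitz a) carlitz_T) (?q ^ Suc j)
      = ?g (Suc j) * ?T ^ (?q ^ Suc j) + ?g j"
    using shift[of ?g] by (simp add: coeff_sum_monom_power card_field_ge_2 n_def del: power_Suc)
  moreover have "coeff (carlitz a ^ ?q) (?q ^ Suc j) = ?g j ^ ?q"
    unfolding form sum_monom_frobenius by (rule shift)
  ultimately show ?thesis
    unfolding eq by (simp add: carlitz_coeff_def algebra_simps del: power_Suc)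
qed

section \<open>Reduction modulo a prime\<close>

text \<open>Lagrange's bound on roots modulo \<open>w\<close>, with incongruent representatives in
  place of elements of a residue ring. Monicity passes to the quotient by x - a, which keeps the
  induction going.\<close>

lemma card_roots_mod_prime_le:
  fixes p :: "'b::idom poly"
  assumes "prime_elem w" "lead_coeff p = 1" "finite S"
    and "\<And>x. x \<in> S \<Longrightarrow> w dvd poly p x"
    and "\<And>x y. x \<in> S \<Longrightarrow> y \<in> S \<Longrightarrow> x \<noteq> y \<Longrightarrow> \<not> w dvd x - y"
  shows "card S \<le> degree p"
  using assms(2-)
proof (induction "degree p" arbitrary: p S)
  case 0
  then have "p = 1"
    by (metis degree_eq_zeroE lead_coeff_pCons(2) one_pCons)
  then have "S = {}"
    using 0 assms(1) by (auto simp: prime_elem_def)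
  then show ?case by simp
next
  case (Suc n)
  show ?case
  proof (cases "S = {}")
    case False
    then obtain a where a: "a \<in> S" by blast
    \<comment> \<open>The remainder \<open>poly p a\<close> is a multiple of \<open>w\<close> but
      need not be zero; modulo \<open>w\<close> this is enough.\<close>
    define s where "s = synthetic_div p a"
    have p: "p = [:-a, 1:] * s + [:poly p a:]"
      using synthetic_div_correct'[of a p] by (simp add: s_def)
    have s0: "s \<noteq> 0"
      using Suc.hyps(2) by (simp add: s_def synthetic_div_eq_0_iff)
    have deg: "degree s = n"
      using Suc.hyps(2) by (simp add: s_def degree_synthetic_div)
    have "degree ([:-a, 1:] * s) = Suc n"
      using s0 deg by (subst degree_mult_eq) simp_all
    then have "lead_coeff ([:poly p a:] + [:-a, 1:] * s) = lead_coeff ([:-a, 1:] * s)"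
      by (intro lead_coeff_add_le) simp
    then have "lead_coeff p = lead_coeff ([:-a, 1:] * s)"
      using p by (metis add.commute)
    then have lc: "lead_coeff s = 1"
      using Suc.prems(1) by (simp only: lead_coeff_mult) simp
    have "card (S - {a}) \<le> degree s"
    proof (rule Suc.hyps(1))
      show "n = degree s" "lead_coeff s = 1" "finite (S - {a})"
        using deg lc Suc.prems(2) by auto
      show "w dvd poly s x" if "x \<in> S - {a}" for x
      proof -
        have "poly p x = (x - a) * poly s x + poly p a"
          by (subst p) (simp add: algebra_simps)
        then have "w dvd (x - a) * poly s x"
          using Suc.prems(3)[of x] Suc.prems(3)[of a] a that by (metis DiffD1 dvd_add_left_iff)
        then show ?thesis
          using assms(1) Suc.prems(4)[of x a] a that by (auto simp: prime_elem_dvd_mult_iff)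
      qed
      show "\<not> w dvd x - y" if "x \<in> S - {a}" "y \<in> S - {a}" "x \<noteq> y" for x y
        using Suc.prems(4) that by blast
    qed
    then show ?thesis
      using a deg Suc.hyps(2) Suc.prems(2) by simp
  qed simp
qed

text \<open>Counts the residues modulo a prime, and later the points C_a(x) generated by a torsion
  point x.\<close>

lemma card_poly_degree_less:
  assumes "n > 0"
  shows "card {f :: 'a::{finite,zero} poly. degree f < n} = CARD('a) ^ n"
    and "finite {f :: 'a poly. degree f < n}"
proof -
  \<comment> \<open>Unlike the degree condition, which is empty for \<open>n = 0\<close>, this set
    is then {0}, so the induction can start there.\<close>
  define P where "P n = {f :: 'a poly. \<forall>i\<ge>n. coeff f i = 0}" for n
  have "finite (P n) \<and> card (P n) = CARD('a) ^ n" for n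
  proof (induction n)
    case 0
    have "P 0 = {0}" by (auto simp: P_def poly_eq_iff)
    then show ?case by simp
  next
    case (Suc n)
    have "P (Suc n) = (\<lambda>(c, f). pCons c f) ` (UNIV \<times> P n)"
    proof (intro equalityI subsetI)
      fix f assume f: "f \<in> P (Suc n)"
      obtain c g where "f = pCons c g" by (cases f)
      moreover from this f have "g \<in> P n"
        by (auto simp: P_def dest: spec[of _ "Suc _"])
      ultimately show "f \<in> (\<lambda>(c, f). pCons c f) ` (UNIV \<times> P n)" by auto
    qed (auto simp: P_def coeff_pCons split: nat.splits)
    moreover have "inj_on (\<lambda>(c, f). pCons c f) (UNIV \<times> P n)"
      by (auto simp: inj_on_def)
    ultimately show ?case
      using Suc.IH by (simp add: card_image card_cartesian_product)
  qed
  moreover have "{f :: 'a poly. degree f < n} = P n"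
    using assms by (auto simp: P_def coeff_eq_0 degree_lessI)
  ultimately show "card {f :: 'a poly. degree f < n} = CARD('a) ^ n"
    "finite {f :: 'a poly. degree f < n}" by simp_all
qed

text \<open>Raising to the power q^j is an endomorphism of F_q-algebras. Once it fixes T modulo
  \<open>w\<close>, it fixes every polynomial modulo \<open>w\<close>.\<close>

lemma dvd_power_card_power_diff:
  fixes w f :: "'a::finite_field poly"
  assumes "w dvd [:0, 1:] ^ (CARD('a) ^ j) - [:0, 1:]"
  shows "w dvd f ^ (CARD('a) ^ j) - f"
proof (induction f)
  case 0
  show ?case by (simp add: zero_power)
next
  case (pCons c f)
  let ?Q = "CARD('a) ^ j" and ?T = "[:0, 1 :: 'a:]"
  have split: "pCons c f = [:c:] + ?T * f" by simp
  have "(pCons c f) ^ ?Q = [:c:] ^ ?Q + (?T * f) ^ ?Q"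
    unfolding split by (rule poly_power_card_power_add)
  also have "[:c:] ^ ?Q = [:c:]"
    by (simp add: poly_const_pow finite_field_power_card_power_eq_same)
  finally have "(pCons c f) ^ ?Q - pCons c f = ?T ^ ?Q * (f ^ ?Q - f) + (?T ^ ?Q - ?T) * f"
    unfolding split by (simp only: power_mult_distrib) (simp only: ring_distribs diff_diff_eq, simp)
  then show ?case
    using pCons.IH assms by (simp only: dvd_add dvd_mult dvd_mult2)
qed

lemma degree_prime_elem_pos:
  fixes w :: "'a::field poly"
  assumes "prime_elem w"
  shows "degree w > 0"
proof (rule ccontr)
  assume "\<not> ?thesis"
  then have "is_unit w"
    using assms is_unit_iff_degree[of w] by (auto simp: prime_elem_def)
  then show False using assms by (simp add: prime_elem_def)
qed

text \<open>Otherwise all q^(degree w) residues modulo \<open>w\<close> would be roots of x^(q^j) -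
  x, whose degree is too small for that.\<close>

lemma prime_not_dvd_power_card_power_diff:
  fixes w :: "'a::finite_field poly"
  assumes "prime_elem w" "0 < j" "j < degree w"
  shows "\<not> w dvd [:0, 1:] ^ (CARD('a) ^ j) - [:0, 1:]"
proof
  assume dvd: "w dvd [:0, 1:] ^ (CARD('a) ^ j) - [:0, 1:]"
  let ?Q = "CARD('a) ^ j"
  define p :: "'a poly poly" where "p = monom 1 ?Q - [:0, 1:]"
  have Q: "?Q > 1"
    using card_field_ge_2[where 'a = 'a] assms(2) by (intro one_less_power) simp_all
  have deg: "degree p = ?Q"
    unfolding p_def diff_conv_add_uminus
    using Q assms(2) card_field_ge_2[where 'a = 'a] by (subst degree_add_eq_left) (simp_all add: degree_monom_eq)
  have "coeff [:0, 1 :: 'a poly:] ?Q = 0"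
    using Q by (intro coeff_eq_0) simp
  then have "coeff p ?Q = 1" by (simp add: p_def)
  then have lc: "lead_coeff p = 1" by (simp add: deg)
  have "card {f :: 'a poly. degree f < degree w} \<le> degree p"
  proof (rule card_roots_mod_prime_le[OF assms(1) lc])
    show "finite {f :: 'a poly. degree f < degree w}"
      using assms by (intro card_poly_degree_less) simp
    show "w dvd poly p f" for f
      using dvd_power_card_power_diff[OF dvd, of f] by (simp add: p_def poly_monom)
    show "\<not> w dvd f - g" if "f \<in> {f. degree f < degree w}" "g \<in> {f. degree f < degree w}" "f \<noteq> g" for f g
    proof
      assume "w dvd f - g"
      then have "degree w \<le> degree (f - g)"
        using that by (intro dvd_imp_degree_le) auto
      moreover have "degree (f - g) < degree w"
        using that by (intro degree_diff_less) auto
      ultimately show False by simp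
    qed
  qed
  then have "CARD('a) ^ degree w \<le> CARD('a) ^ j"
    using assms deg by (simp add: card_poly_degree_less)
  then show False
    using assms(3) card_field_ge_2[where 'a = 'a] by (simp add: power_le_imp_le_exp)
qed

section \<open>Reduction of \<open>carlitz w\<close> modulo \<open>w\<close>\<close>

lemma prime_dvd_carlitz_coeff:
  fixes w :: "'a::finite_field poly"
  assumes "prime_elem w" "i < degree w"
  shows "w dvd carlitz_coeff w i"
  using assms(2)
proof (induction i)
  case 0
  show ?case by (simp add: carlitz_coeff_0)
next
  case (Suc i)
  have "w dvd carlitz_coeff w i ^ CARD('a) - carlitz_coeff w i"
    using Suc card_field_ge_2[where 'a = 'a] by (intro dvd_diff dvd_power_le[of w _ 1, simplified]) simp_all
  \<comment> \<open>By induction \<open>w\<close> divides the right-hand side of the coefficient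
    recursion; it cannot divide T^(q^(i+1)) - T, as 0 < i+1 < degree w.\<close>
  then have "w dvd [:0, 1:] ^ (CARD('a) ^ Suc i) - [:0, 1:] \<or> w dvd carlitz_coeff w (Suc i)"
    unfolding carlitz_coeff_Suc[symmetric] using assms(1) by (simp only: prime_elem_dvd_mult_iff)
  then show ?case
    using prime_not_dvd_power_card_power_diff[OF assms(1) _ Suc.prems] by blast
qed

lemma prime_dvd_coeff_carlitz:
  fixes w :: "'a::finite_field poly"
  assumes "prime_elem w" "n \<noteq> CARD('a) ^ degree w"
  shows "w dvd coeff (carlitz w) n"
proof (cases "\<exists>i. n = CARD('a) ^ i")
  case True
  then obtain i where i: "n = CARD('a) ^ i" by blast
  then consider "i < degree w" | "i > degree w"
    using assms(2) by (cases i "degree w" rule: linorder_cases) auto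
  then show ?thesis
  proof cases
    case 1
    then show ?thesis using prime_dvd_carlitz_coeff[OF assms(1) 1] i by (simp add: carlitz_coeff_def)
  next
    case 2
    then show ?thesis using carlitz_coeff_eq_0[OF 2] i by (simp add: carlitz_coeff_def)
  qed
qed (simp add: coeff_carlitz_eq_0)

text \<open>All coefficients but the leading one vanish modulo \<open>w\<close>, and the leading one
  is 1.\<close>

lemma monic_prime_dvd_carlitz_diff:
  fixes w :: "'a::finite_field poly"
  assumes "monic_prime w"
  shows "w dvd poly (carlitz w) y - y ^ (CARD('a) ^ degree w)"
proof -
  have w: "prime_elem w" "lead_coeff w = 1"
    using assms by (simp_all add: monic_prime_def)
  have "[:w:] dvd carlitz w - monom 1 (CARD('a) ^ degree w)"
    unfolding const_poly_dvd_iff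
  proof
    fix n
    show "w dvd coeff (carlitz w - monom 1 (CARD('a) ^ degree w)) n"
    proof (cases "n = CARD('a) ^ degree w")
      case True
      then show ?thesis
        using carlitz_coeff_degree[of w] w(2) by (simp add: carlitz_coeff_def one_pCons)
    next
      case False
      then show ?thesis using prime_dvd_coeff_carlitz[OF w(1)] by simp
    qed
  qed
  then obtain h where "carlitz w - monom 1 (CARD('a) ^ degree w) = [:w:] * h"
    by (elim dvdE)
  then have "poly (carlitz w - monom 1 (CARD('a) ^ degree w)) y = w * poly h y"
    by simp
  then show ?thesis by (simp add: poly_monom)
qed

text \<open>Modulo \<open>w\<close> the value is a power of \<open>y\<close>. This permits powers of
  \<open>w\<close> to be stripped from an annihilating polynomial.\<close>

lemma monic_prime_dvd_carlitz_iff: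
  fixes w :: "'a::finite_field poly"
  assumes "monic_prime w"
  shows "w dvd poly (carlitz w) y \<longleftrightarrow> w dvd y"
proof -
  have "w dvd poly (carlitz w) y \<longleftrightarrow> w dvd y ^ (CARD('a) ^ degree w)"
    using monic_prime_dvd_carlitz_diff[OF assms, of y] dvd_diff_commute
    by (metis add_diff_cancel_left' diff_add_cancel dvd_add_right_iff)
  then show ?thesis
    using assms by (simp add: prime_elem_dvd_power_iff monic_prime_def)
qed

text \<open>This is \<open>R\<^sub>a(x) = C\<^sub>a(x) / x\<close>.\<close>

definition carlitz_red :: "'a::finite_field poly \<Rightarrow> 'a poly poly" where
  "carlitz_red a = poly_shift 1 (carlitz a)"

lemma carlitz_eq_pCons: "carlitz a = pCons 0 (carlitz_red a)"
  by (rule poly_eqI) (auto simp: carlitz_red_def coeff_poly_shift coeff_pCons split: nat.split)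

lemma coeff_carlitz_red_0: "coeff (carlitz_red a) 0 = a"
  using carlitz_coeff_0[of a] by (simp add: carlitz_red_def coeff_poly_shift carlitz_coeff_def)

lemma poly_carlitz_red_cong:
  "y dvd poly (carlitz_red a) y - a"
proof (cases "carlitz_red a")
  case (pCons c r)
  then show ?thesis using coeff_carlitz_red_0[of a] by simp
qed

lemma carlitz_eval: "poly (carlitz a) y = y * poly (carlitz_red a) y"
  by (simp add: carlitz_eq_pCons)

lemma dvd_carlitz: "w dvd y \<Longrightarrow> w dvd poly (carlitz a) y"
  by (simp add: carlitz_eval)

text \<open>Expand R_w(y) = w + c y + ...: the terms beyond the linear one are multiples of y^2,
  hence of w^2, and so is c y once \<open>w\<close> divides c.\<close>

lemma square_dvd_carlitz_red_diff:
  fixes w :: "'a::finite_field poly"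
  assumes "prime_elem w" "w dvd y" "\<not> (CARD('a) = 2 \<and> degree w = 1)"
  shows "w\<^sup>2 dvd poly (carlitz_red w) y - w"
proof -
  obtain r where r: "carlitz_red w = pCons w r"
    using coeff_carlitz_red_0[of w] by (cases "carlitz_red w") auto
  obtain c s where s: "r = pCons c s" by (cases r)
  \<comment> \<open>As a coefficient of \<open>carlitz w\<close>, \<open>c\<close> is a multiple of
    \<open>w\<close> unless 2 is the top exponent q^(degree w), which is the excluded case.\<close>
  have "coeff (carlitz w) 2 = c"
    by (simp add: carlitz_eq_pCons r s numeral_2_eq_2)
  moreover have "CARD('a) ^ degree w \<noteq> 2"
  proof
    assume eq: "CARD('a) ^ degree w = 2"
    have "degree w \<noteq> 1" using eq assms(3) by auto
    then have "degree w \<ge> 2"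
      using degree_prime_elem_pos[OF assms(1)] by linarith
    then have "2 ^ 2 \<le> CARD('a) ^ degree w"
      using card_field_ge_2[where 'a = 'a]
      by (meson le_trans one_le_numeral power_increasing power_mono zero_le)
    then show False using eq by simp
  qed
  ultimately have "w dvd c"
    using prime_dvd_coeff_carlitz[OF assms(1), of 2] by metis
  then have "w dvd poly r y"
    using assms(2) by (simp add: s)
  then show ?thesis
    using assms(2) by (simp add: r power2_eq_square mult_dvd_mono)
qed

section \<open>Torsion points\<close>

abbreviation poly_to_ac :: "'a::finite_field poly \<Rightarrow> 'a poly fract alg_closure" where
  "poly_to_ac c \<equiv> to_ac (to_fract c)"

abbreviation lift_ac :: "'a::finite_field poly poly \<Rightarrow> 'a poly fract alg_closure poly" where
  "lift_ac p \<equiv> map_poly poly_to_ac p"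

lemma lift_ac_add: "lift_ac (p + q) = lift_ac p + lift_ac q"
  by (rule poly_eqI) (simp add: coeff_map_poly)

lemma lift_ac_smult: "lift_ac (smult c p) = smult (poly_to_ac c) (lift_ac p)"
  by (rule poly_eqI) (simp add: coeff_map_poly)

lemma lift_ac_pCons: "lift_ac (pCons c p) = pCons (poly_to_ac c) (lift_ac p)"
  by (simp add: map_poly_pCons)

lemma lift_ac_mult: "lift_ac (p * q) = lift_ac p * lift_ac q"
  by (induction p) (simp_all add: lift_ac_add lift_ac_smult lift_ac_pCons)

lemma lift_ac_power: "lift_ac (p ^ n) = lift_ac p ^ n"
  by (induction n) (simp_all add: lift_ac_mult)

lemma lift_ac_pcompose: "lift_ac (pcompose p q) = pcompose (lift_ac p) (lift_ac q)"
  by (induction p) (simp_all add: pcompose_pCons lift_ac_add lift_ac_mult lift_ac_pCons)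

lemma degree_lift_ac: "degree (lift_ac p) = degree p"
  by (rule degree_map_poly) simp

lemma poly_to_ac_of_nat: "poly_to_ac (of_nat n :: 'a::finite_field poly) = of_nat n"
  by (induction n) simp_all

lemma ac_power_card_add:
  fixes x y :: "'a::finite_field poly fract alg_closure"
  shows "(x + y) ^ CARD('a) = x ^ CARD('a) + y ^ CARD('a)"
proof (rule power_card_field_add)
  fix i assume "0 < i" "i < CARD('a)"
  then have "of_nat (CARD('a) choose i) = (0 :: 'a poly)"
    by (simp add: of_nat_poly of_nat_choose_card_eq_0)
  then show "of_nat (CARD('a) choose i) = (0 :: 'a poly fract alg_closure)"
    by (metis poly_to_ac_of_nat to_ac_0 to_fract_0)
qed

section \<open>The module structure on the algebraic closure\<close>

lemma carlitz_act_add: "carlitz_act (a + b) x = carlitz_act a x + carlitz_act b x"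
  by (simp add: carlitz_act_def carlitz_add lift_ac_add)

lemma carlitz_act_0 [simp]: "carlitz_act 0 x = 0"
  by (simp add: carlitz_act_def)

lemma carlitz_act_1 [simp]: "carlitz_act 1 x = x"
  by (simp add: carlitz_act_def carlitz_1 lift_ac_pCons)

lemma carlitz_act_diff: "carlitz_act (a - b) x = carlitz_act a x - carlitz_act b x"
  using carlitz_act_add[of "a - b" b x] by simp

lemma carlitz_act_mult: "carlitz_act (a * b) x = carlitz_act a (carlitz_act b x)"
  by (simp add: carlitz_act_def carlitz_mult lift_ac_pcompose poly_pcompose)

lemma carlitz_act_zero_right [simp]: "carlitz_act a 0 = 0"
  by (simp add: carlitz_act_def carlitz_eq_pCons lift_ac_pCons)

lemma carlitz_act_pCons:
  fixes a :: "'a::finite_field poly"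
  shows "carlitz_act (pCons c a) x =
    poly_to_ac [:c:] * x + poly_to_ac [:0, 1:] * carlitz_act a x + carlitz_act a x ^ CARD('a)"
  by (simp add: carlitz_act_def carlitz_pCons pcompose_carlitz_T lift_ac_add lift_ac_smult
      lift_ac_power lift_ac_pCons)

lemma carlitz_act_add_right: "carlitz_act a (x + y) = carlitz_act a x + carlitz_act a y"
proof (induction a)
  case (pCons c a)
  then show ?case
    by (simp add: carlitz_act_pCons ac_power_card_add ring_distribs)
qed simp

lemma carlitz_act_eq_red: "carlitz_act a x = x * poly (lift_ac (carlitz_red a)) x"
  by (simp add: carlitz_act_def carlitz_eq_pCons lift_ac_pCons)

lemma carlitz_act_surj:
  fixes a :: "'a::finite_field poly"
  assumes "a \<noteq> 0"
  obtains y where "carlitz_act a y = x"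
proof -
  \<comment> \<open>C_a(Y) - x has degree q^(degree a), at least 1 even for constant
    \<open>a\<close>, so it has a root.\<close>
  have "degree (lift_ac (carlitz a) + [:-x:]) = CARD('a) ^ degree a"
    using assms by (subst degree_add_eq_left) (simp_all add: degree_lift_ac degree_carlitz)
  then obtain y where "poly (lift_ac (carlitz a) + [:-x:]) y = 0"
    using alg_closed_imp_poly_has_root[of "lift_ac (carlitz a) + [:-x:]"] by auto
  then show ?thesis
    by (intro that[of y]) (simp add: carlitz_act_def)
qed

text \<open>R_a has positive degree q^(degree a) - 1, so it has a root; this root is nonzero because
  R_a(0) = a.\<close>

lemma carlitz_torsion_nontrivial:
  fixes a :: "'a::finite_field poly"
  assumes "degree a > 0"
  obtains z where "carlitz_act a z = 0" "z \<noteq> 0"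
proof -
  have a0: "a \<noteq> 0" using assms by auto
  have "carlitz_red a \<noteq> 0"
    using coeff_carlitz_red_0[of a] a0 by auto
  then have "Suc (degree (carlitz_red a)) = CARD('a) ^ degree a"
    using degree_carlitz[OF a0] by (simp add: carlitz_eq_pCons)
  moreover have "1 < CARD('a) ^ degree a"
    using assms card_field_ge_2[where 'a = 'a] by (intro one_less_power) simp_all
  ultimately have "degree (lift_ac (carlitz_red a)) > 0"
    by (simp add: degree_lift_ac)
  then obtain z where z: "poly (lift_ac (carlitz_red a)) z = 0"
    using alg_closed_imp_poly_has_root by blast
  have "poly (lift_ac (carlitz_red a)) 0 = poly_to_ac a"
    by (simp add: poly_0_coeff_0 coeff_map_poly coeff_carlitz_red_0)
  then have "z \<noteq> 0" using z a0 by auto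
  then show ?thesis using that z by (simp add: carlitz_act_eq_red)
qed

lemma card_carlitz_torsion_le:
  fixes a :: "'a::finite_field poly"
  assumes "a \<noteq> 0"
  shows "card (carlitz_torsion a) \<le> CARD('a) ^ degree a" "finite (carlitz_torsion a)"
proof -
  have "carlitz a \<noteq> 0" 
    using assms coeff_carlitz_red_0[of a] by (auto simp: carlitz_eq_pCons)
  then have "lift_ac (carlitz a) \<noteq> 0"
    by (subst map_poly_eq_0_iff) auto
  then show "card (carlitz_torsion a) \<le> CARD('a) ^ degree a" "finite (carlitz_torsion a)"
    using card_poly_roots_bound[of "lift_ac (carlitz a)"] poly_roots_finite[of "lift_ac (carlitz a)"] assms
    by (simp_all add: carlitz_torsion_def carlitz_act_def degree_lift_ac degree_carlitz)
qed

section \<open>Ideals and prime factors of polynomials over a field\<close>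

lemma poly_ideal_principal:
  fixes I :: "'b::field poly set"
  assumes "\<And>f g. f \<in> I \<Longrightarrow> g \<in> I \<Longrightarrow> f - g \<in> I" "\<And>f g. f \<in> I \<Longrightarrow> g * f \<in> I"
    and "a \<in> I" "a \<noteq> 0"
  obtains p where "p \<noteq> 0" "\<And>f. f \<in> I \<longleftrightarrow> p dvd f"
proof -
  \<comment> \<open>For a nonzero element of least degree, remainders on division by it stay in the
    ideal and hence vanish.\<close>
  obtain p where p: "p \<in> I" "p \<noteq> 0" "\<And>f. f \<in> I \<Longrightarrow> f \<noteq> 0 \<Longrightarrow> degree p \<le> degree f"
    using ex_has_least_nat[of "\<lambda>f. f \<in> I \<and> f \<noteq> 0" a degree] assms(3,4) by blast
  have "p dvd f" if "f \<in> I" for f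
  proof -
    have "f mod p \<in> I"
      using assms(1)[OF that assms(2)[OF p(1), of "f div p"]] by (simp add: minus_div_mult_eq_mod)
    then have "f mod p = 0"
      using p(2,3) degree_mod_less'[of p f] by (metis not_less)
    then show ?thesis by auto
  qed
  then show ?thesis
    using p(1,2) assms(2) by (intro that[of p]) (auto simp: mult.commute elim!: dvdE)
qed

text \<open>A generator of the ideal spanned by \<open>a\<close> and \<open>p\<close> divides both,
  so by irreducibility of \<open>p\<close> it is a unit.\<close>

lemma coprime_bezout:
  fixes a p :: "'b::field poly"
  assumes "prime_elem p" "\<not> p dvd a"
  obtains r s where "r * a + s * p = 1"
proof -
  define I where "I = {f. \<exists>r s. f = r * a + s * p}"
  obtain d where d: "d \<noteq> 0" "\<And>f. f \<in> I \<longleftrightarrow> d dvd f"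
  proof (rule poly_ideal_principal[of I p])
    show "f - g \<in> I" if f: "f \<in> I" and g: "g \<in> I" for f g
    proof -
      obtain r s where "f = r * a + s * p"
        using f unfolding I_def by blast
      moreover obtain r' s' where "g = r' * a + s' * p"
        using g unfolding I_def by blast
      ultimately have "f - g = (r - r') * a + (s - s') * p" by (simp add: algebra_simps)
      then show ?thesis unfolding I_def by blast
    qed
    show "g * f \<in> I" if f: "f \<in> I" for f g
    proof -
      obtain r s where "f = r * a + s * p" using f unfolding I_def by blast
      then have "g * f = (g * r) * a + (g * s) * p" by (simp add: algebra_simps)
      then show ?thesis unfolding I_def by blast
    qed
    have "p = 0 * a + 1 * p" by simp
    then show "p \<in> I" unfolding I_def by blast
    show "p \<noteq> 0" using assms by auto
  qed (use that in blast)
  have "a = 1 * a + 0 * p" "p = 0 * a + 1 * p" by simp_all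
  then have "a \<in> I" "p \<in> I" unfolding I_def by blast+
  then have "d dvd a" "d dvd p" using d by auto
  then have "is_unit d"
  proof -
    obtain k where k: "p = d * k" using \<open>d dvd p\<close> by blast
    \<comment> \<open>With a unit cofactor, \<open>p\<close> would divide \<open>d\<close> and
      therefore \<open>a\<close>.\<close>
    have "\<not> is_unit k"
      using k \<open>d dvd a\<close> assms(2) by (metis dvd_trans dvd_refl mult_unit_dvd_iff)
    then show ?thesis
      using k irreducibleD[OF prime_elem_imp_irreducible[OF assms(1)]] by blast
  qed
  then have "1 \<in> I" using d by simp
  then obtain r s where "1 = r * a + s * p" unfolding I_def by blast
  then show ?thesis using that by simp
qed

text \<open>A nonconstant divisor of least degree is irreducible, hence prime; scaling makes it
  monic.\<close>

lemma exists_prime_dvd: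
  fixes f :: "'b::field poly"
  assumes "degree f > 0"
  obtains p where "monic_prime p" "p dvd f"
proof -
  let ?P = "\<lambda>p. degree p > 0 \<and> p dvd f"
  obtain p where p: "?P p" "\<And>r. ?P r \<Longrightarrow> degree p \<le> degree r"
    using ex_has_least_nat[of ?P f degree] assms dvd_refl by metis
  have f0: "f \<noteq> 0" using assms by auto
  have p0: "p \<noteq> 0" using p by auto
  have "irreducible p"
  proof (rule irreducibleI)
    show "p \<noteq> 0" by fact
    show "\<not> is_unit p" using p is_unit_iff_degree[of p] p0 by auto
    fix a b assume ab: "p = a * b"
    then have nz: "a \<noteq> 0" "b \<noteq> 0" using p0 by auto
    have deg: "degree p = degree a + degree b"
      using nz by (simp add: ab degree_mult_eq)
    have "a dvd f" using p(1) ab dvd_mult_left by blast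
    then have "degree a = 0 \<or> degree b = 0"
      using p(2)[of a] deg by (cases "degree a > 0") auto
    then show "is_unit a \<or> is_unit b"
      using nz by (simp add: is_unit_iff_degree)
  qed
  then have prime: "prime_elem p" by (rule field_poly_irreducible_imp_prime)
  define q where "q = smult (inverse (lead_coeff p)) p"
  have u: "q = [:inverse (lead_coeff p):] * p" "is_unit [:inverse (lead_coeff p):]"
    using p0 by (simp_all add: q_def is_unit_const_poly_iff dvd_field_iff)
  have "prime_elem q"
    unfolding u(1) using prime u(2) by (simp only: prime_elem_mult_unit_left)
  moreover have "lead_coeff q = 1" using p0 by (simp add: q_def)
  moreover have "q dvd f" using p(1) p0 by (simp add: q_def smult_dvd_iff)
  ultimately show ?thesis using that[of q] by (simp add: monic_prime_def)
qed

text \<open>Division of the point \<open>x\<close> by the prime \<open>p\<close>, adjusted by a \<open>p\<close>-torsion point if necessary.\<close>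

lemma exact_order_mult_prime:
  fixes m p :: "'a::finite_field poly"
  assumes m0: "m \<noteq> 0" and p: "prime_elem p"
    and x: "\<And>n. carlitz_act n x = 0 \<longleftrightarrow> m dvd n"
  obtains y where "\<And>n. carlitz_act n y = 0 \<longleftrightarrow> m * p dvd n"
proof -
  have p0: "p \<noteq> 0" using p by auto
  have commute: "carlitz_act a (carlitz_act b z) = carlitz_act b (carlitz_act a z)" for a b z
    by (metis carlitz_act_mult mult.commute)
  obtain y0 where y0: "carlitz_act p y0 = x"
    using carlitz_act_surj[OF p0] by blast
  obtain y where y: "carlitz_act p y = x" "carlitz_act m y \<noteq> 0"
  proof (cases "carlitz_act m y0 = 0")
    case False
    then show ?thesis using that y0 by blast
  next
    case True
    \<comment> \<open>If m = k p, then C_k(x) = C_m(y0) = 0, so \<open>m\<close> divides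
      \<open>k\<close> and \<open>p\<close> would be a unit.\<close>
    have ndvd: "\<not> p dvd m"
    proof
      assume "p dvd m"
      then obtain k where k: "m = k * p" by (metis dvdE mult.commute)
      then have "carlitz_act k x = 0"
        using True y0 by (simp add: carlitz_act_mult)
      then have "k * p dvd k" using x k by simp
      then have "p dvd 1" using m0 k by (metis dvd_times_left_cancel_iff mult_eq_0_iff mult.right_neutral)
      then show False using p by (simp add: prime_elem_def)
    qed
    \<comment> \<open>Adding \<open>z\<close> to \<open>y0\<close> keeps the image \<open>x\<close>
      under C_p. Bezout gives z = C_r(C_m(z)), so C_m(z) is nonzero.\<close>
    obtain z where z: "carlitz_act p z = 0" "z \<noteq> 0"
      using carlitz_torsion_nontrivial degree_prime_elem_pos[OF p] by blast
    obtain r s where rs: "r * m + s * p = 1"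
      using coprime_bezout[OF p ndvd] by blast
    have "z = carlitz_act (r * m + s * p) z" by (simp add: rs)
    also have "\<dots> = carlitz_act r (carlitz_act m z)"
      using z by (simp add: carlitz_act_add carlitz_act_mult)
    finally have "carlitz_act m z \<noteq> 0" using z by auto
    then show ?thesis
      using that[of "y0 + z"] y0 z True by (simp add: carlitz_act_add_right)
  qed
  have "m * p dvd n" if n: "carlitz_act n y = 0" for n
  proof -
    have "carlitz_act n x = 0"
      using n y(1) commute carlitz_act_zero_right by metis
    then obtain k where k: "n = m * k" using x by blast
    show ?thesis
    proof (cases "p dvd k")
      case True
      then show ?thesis by (simp add: k)
    next
      case False
      then obtain r s where rs: "r * k + s * p = 1"
        using coprime_bezout[OF p] by blast
      \<comment> \<open>Multiplying the Bezout relation by \<open>m\<close> writes \<open>m\<close>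
        through \<open>n\<close> and \<open>m * p\<close>, which both kill \<open>y\<close>, against
        the choice of \<open>y\<close>.\<close>
      have "carlitz_act m y = carlitz_act (r * n + s * (m * p)) y"
        using rs k by (metis distrib_left mult.left_commute mult.right_neutral)
      also have "\<dots> = 0"
        using n x[of m] y by (simp add: carlitz_act_add carlitz_act_mult)
      finally show ?thesis using y by simp
    qed
  qed
  moreover have "carlitz_act n y = 0" if n: "m * p dvd n" for n
  proof -
    obtain k where "n = k * (m * p)" using n by (metis dvdE mult.commute)
    then show ?thesis using x[of m] y by (simp add: carlitz_act_mult)
  qed
  ultimately show ?thesis by (intro that[of y] iffI)
qed

text \<open>Prime factors are removed one at a time, down to a unit, for which the point 0
  serves.\<close>

lemma exact_order_exists:
  fixes m :: "'a::finite_field poly"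
  assumes "m \<noteq> 0"
  shows "\<exists>x. \<forall>n. carlitz_act n x = 0 \<longleftrightarrow> m dvd n"
  using assms
proof (induction "degree m" arbitrary: m rule: less_induct)
  case less
  show ?case
  proof (cases "degree m = 0")
    case True
    then have "is_unit m" using less.prems by (simp add: is_unit_iff_degree)
    then show ?thesis by (intro exI[of _ 0]) (auto intro: dvd_trans)
  next
    case False
    then obtain p where p: "monic_prime p" "p dvd m"
      using exists_prime_dvd by blast
    then obtain k where k: "m = k * p" by (metis dvdE mult.commute)
    have prime: "prime_elem p" using p by (simp add: monic_prime_def)
    have nz: "k \<noteq> 0" "p \<noteq> 0" using less.prems k by auto
    then have "degree k < degree m"
      using degree_prime_elem_pos[OF prime] by (simp add: k degree_mult_eq)
    then obtain x where "\<And>n. carlitz_act n x = 0 \<longleftrightarrow> k dvd n"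
      using less.hyps nz by blast
    then show ?thesis
      using exact_order_mult_prime[OF nz(1) prime] k by metis
  qed
qed

text \<open>The q^(degree m) polynomials of degree below \<open>degree m\<close> give distinct
  points C_a(x), and C_m has no more roots than that, so these exhaust the torsion.\<close>

lemma exact_order_imp_primitive:
  fixes m :: "'a::finite_field poly"
  assumes "degree m > 0" and x: "\<And>n. carlitz_act n x = 0 \<longleftrightarrow> m dvd n"
  shows "primitive_carlitz_root m x"
proof -
  have m0: "m \<noteq> 0" using assms by auto
  let ?S = "{f :: 'a poly. degree f < degree m}"
  have inj: "inj_on (\<lambda>a. carlitz_act a x) ?S"
  proof (rule inj_onI)
    fix f g assume fg: "f \<in> ?S" "g \<in> ?S" "carlitz_act f x = carlitz_act g x"
    then have "m dvd f - g"
      by (simp add: carlitz_act_diff flip: x)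
    moreover have "degree (f - g) < degree m"
      using fg by (intro degree_diff_less) auto
    ultimately show "f = g"
      using dvd_imp_degree_le[of m "f - g"] by auto
  qed
  have sub: "range (\<lambda>a. carlitz_act a x) \<subseteq> carlitz_torsion m"
    using x by (auto simp: carlitz_torsion_def simp flip: carlitz_act_mult)
  have "card ((\<lambda>a. carlitz_act a x) ` ?S) = CARD('a) ^ degree m"
    using inj assms(1) by (simp add: card_image card_poly_degree_less)
  then have "(\<lambda>a. carlitz_act a x) ` ?S = carlitz_torsion m"
    using sub card_carlitz_torsion_le[OF m0] by (intro card_seteq) auto
  then have "range (\<lambda>a. carlitz_act a x) = carlitz_torsion m"
    using sub by blast
  then show ?thesis
    using x[of m] by (simp add: primitive_carlitz_root_def carlitz_torsion_def)
qed

lemma primitive_root_exists: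
  fixes m :: "'a::finite_field poly"
  assumes "degree m > 0"
  shows "\<exists>x. primitive_carlitz_root m x"
proof -
  have "m \<noteq> 0" using assms by auto
  then show ?thesis using exact_order_exists exact_order_imp_primitive[OF assms] by metis
qed

text \<open>The root \<open>x\<close> generates a point \<open>y\<close> whose annihilator is
  exactly \<open>m\<close>, so whatever kills \<open>x\<close> also kills \<open>y\<close>.\<close>

lemma primitive_root_exact_order:
  fixes m :: "'a::finite_field poly"
  assumes "m \<noteq> 0" "primitive_carlitz_root m x"
  shows "carlitz_act n x = 0 \<longleftrightarrow> m dvd n"
proof
  assume n: "carlitz_act n x = 0"
  obtain y where y: "\<And>n. carlitz_act n y = 0 \<longleftrightarrow> m dvd n"
    using exact_order_exists[OF assms(1)] by blast
  then have "y \<in> carlitz_torsion m"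
    by (simp add: carlitz_torsion_def)
  then have "y \<in> range (\<lambda>a. carlitz_act a x)"
    using assms(2) by (simp add: primitive_carlitz_root_def)
  then obtain a where "y = carlitz_act a x" by blast
  then have "carlitz_act n y = carlitz_act a (carlitz_act n x)"
    by (metis carlitz_act_mult mult.commute)
  then show "m dvd n" using n y by simp
next
  assume "m dvd n"
  then obtain k where "n = k * m" by (metis dvdE mult.commute)
  then show "carlitz_act n x = 0"
    using assms(2) by (simp add: carlitz_act_mult primitive_carlitz_root_def carlitz_torsion_def)
qed

section \<open>Cyclotomic polynomials and annihilators\<close>

lemma map_poly_to_ac_add:
  "map_poly to_ac (f + g) = map_poly to_ac f + map_poly to_ac g"
  by (rule poly_eqI) (simp add: coeff_map_poly)

lemma map_poly_to_ac_mult: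
  "map_poly to_ac (f * g) = map_poly to_ac f * map_poly to_ac g"
  by (rule poly_eqI) (simp add: coeff_map_poly coeff_mult to_ac_sum)

text \<open>The remainder on division by \<open>p\<close> vanishes at \<open>x\<close> too and has
  smaller degree, unless it is zero.\<close>

lemma min_poly_dvd:
  assumes "is_min_poly x p" "poly (map_poly to_ac f) x = 0"
  shows "p dvd f"
proof -
  have p0: "p \<noteq> 0" using assms(1) by (auto simp: is_min_poly_def)
  have "map_poly to_ac f = map_poly to_ac p * map_poly to_ac (f div p) + map_poly to_ac (f mod p)"
    by (metis map_poly_to_ac_add map_poly_to_ac_mult mult_div_mod_eq)
  then have "poly (map_poly to_ac (f mod p)) x = 0"
    using assms by (simp add: is_min_poly_def)
  then have "f mod p = 0"
    using assms(1) degree_mod_less'[OF p0, of f] by (auto simp: is_min_poly_def not_le[symmetric])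
  then show ?thesis by auto
qed

lemma poly_lift_ac: "poly (lift_ac p) x = poly (map_poly to_ac (map_poly to_fract p)) x"
  by (simp add: map_poly_map_poly comp_def)

section \<open>Denominators and integrality of the cyclotomic polynomial\<close>

lemma clear_denominators:
  fixes p :: "'b::idom fract poly"
  shows "\<exists>a P. a \<noteq> 0 \<and> smult (to_fract a) p = map_poly to_fract P"
proof (induction p)
  case 0
  show ?case by (intro exI[of _ 1] exI[of _ 0]) simp
next
  case (pCons c p)
  then obtain a P where a: "a \<noteq> 0" "smult (to_fract a) p = map_poly to_fract P" by blast
  obtain x y where c: "c = Fract x y" "y \<noteq> 0" by (cases c)
  have "smult (to_fract (a * y)) (pCons c p) = map_poly to_fract (pCons (a * x) (smult y P))"
    using c a by (simp add: map_poly_pCons Fract_conv_to_fract flip: a(2)) (simp add: mult.commute)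
  then show ?case using a(1) c(2) by (metis mult_eq_0_iff)
qed

text \<open>Choosing \<open>a\<close> of least degree makes \<open>P\<close> primitive: a prime
  dividing \<open>P\<close> would divide \<open>a\<close> as well and could be cancelled.\<close>

lemma clear_denominators_minimal:
  fixes p :: "'b::field poly fract poly"
  assumes "lead_coeff p = 1"
  obtains a P where "a \<noteq> 0" "smult (to_fract a) p = map_poly to_fract P"
    "\<And>l. prime_elem l \<Longrightarrow> \<not> [:l:] dvd P"
proof -
  let ?R = "\<lambda>a. a \<noteq> 0 \<and> (\<exists>P. smult (to_fract a) p = map_poly to_fract P)"
  obtain a0 where "?R a0" using clear_denominators[of p] by blast
  then obtain a where a: "?R a" "\<And>b. ?R b \<Longrightarrow> degree a \<le> degree b"
    using ex_has_least_nat[of ?R a0 degree] by metis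
  then obtain P where P: "smult (to_fract a) p = map_poly to_fract P" by blast
  have "\<not> [:l:] dvd P" if l: "prime_elem l" for l
  proof
    assume "[:l:] dvd P"
    then obtain P' where P': "P = [:l:] * P'" by blast
    have l0: "l \<noteq> 0" using l by auto
    \<comment> \<open>As \<open>p\<close> is monic, \<open>a\<close> is itself a coefficient of
      \<open>P\<close>, hence a multiple of \<open>l\<close>.\<close>
    have "coeff (smult (to_fract a) p) (degree p) = to_fract (coeff P (degree p))"
      unfolding P by (simp add: coeff_map_poly)
    then have "to_fract a = to_fract (l * coeff P' (degree p))"
      using assms P' by simp
    then have al: "a = l * coeff P' (degree p)"
      by (simp only: to_fract_eq_iff)
    define b where "b = coeff P' (degree p)"
    have "smult (to_fract l) (smult (to_fract b) p) = smult (to_fract l) (map_poly to_fract P')"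
      using P by (simp add: al b_def P')
    then have "smult (to_fract l) (smult (to_fract b) p - map_poly to_fract P') = 0"
      by (simp only: smult_diff_right diff_self)
    then have "smult (to_fract b) p = map_poly to_fract P'"
      using l0 by (simp only: smult_eq_0_iff to_fract_eq_0_iff) simp
    moreover have "b \<noteq> 0" using a(1) al by (auto simp: b_def)
    ultimately have "degree a \<le> degree b" using a(2) by blast
    then show False
      using al l0 \<open>b \<noteq> 0\<close> degree_prime_elem_pos[OF l] by (simp add: b_def degree_mult_eq)
  qed
  then show ?thesis using that a(1) P by blast
qed

text \<open>Gauss's lemma for monic factors, stated without content because \<open>'b poly\<close> carries no gcd when
  \<open>'b\<close> is only of class \<open>field\<close>.\<close>

lemma monic_factor_integral:
  fixes p q :: "'b::field poly fract poly"
  assumes "p * q = map_poly to_fract F" "lead_coeff p = 1" "lead_coeff q = 1"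
  shows "\<exists>P. p = map_poly to_fract P"
proof -
  obtain a P where P: "a \<noteq> 0" "smult (to_fract a) p = map_poly to_fract P"
    "\<And>l. prime_elem l \<Longrightarrow> \<not> [:l:] dvd P"
    using clear_denominators_minimal[OF assms(2)] by blast
  obtain b Q where Q: "b \<noteq> 0" "smult (to_fract b) q = map_poly to_fract Q"
    "\<And>l. prime_elem l \<Longrightarrow> \<not> [:l:] dvd Q"
    using clear_denominators_minimal[OF assms(3)] by blast
  have "map_poly to_fract (P * Q) = map_poly to_fract (smult (a * b) F)"
    by (simp add: mult.commute flip: P(2) Q(2) assms(1))
  then have PQ: "P * Q = smult (a * b) F" by (simp only: fract_poly_eq_iff)
  have "degree a = 0"
  proof (rule ccontr)
    assume "degree a \<noteq> 0"
    then obtain l where l: "monic_prime l" "l dvd a"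
      using exists_prime_dvd[of a] by blast
    then have prime: "prime_elem l" by (simp add: monic_prime_def)
    \<comment> \<open>The constant \<open>l\<close> remains prime in the ring of polynomials in x,
      so it must divide \<open>P\<close> or \<open>Q\<close>, against their primitivity.\<close>
    have "[:l:] dvd P * Q"
      unfolding PQ using l(2) by (simp add: const_poly_dvd_iff)
    then show False
      using P(3) Q(3) prime by (simp add: prime_elem_const_poly_iff prime_elem_dvd_mult_iff)
  qed
  then have "is_unit a" using P(1) by (simp add: is_unit_iff_degree)
  \<comment> \<open>A nonzero constant \<open>a\<close> is invertible in the coefficient ring, so
    the clearing of denominators can be undone there.\<close>
  then obtain c where c: "1 = a * c" by blast
  have "p = smult (to_fract (a * c)) p" by (simp add: c[symmetric])
  also have "\<dots> = smult (to_fract c) (smult (to_fract a) p)" by (simp add: mult.commute)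
  also have "\<dots> = map_poly to_fract (smult c P)" by (simp add: P(2))
  finally show ?thesis by blast
qed

text \<open>The minimal polynomial divides C_m, which is monic over A, so Gauss's lemma makes it
  integral. Injectivity of the embedding then settles the definite description.\<close>

lemma carlitz_cyclotomic_eq_min_poly:
  fixes m :: "'a::finite_field poly"
  assumes "lead_coeff m = 1" "degree m > 0"
  obtains x where "primitive_carlitz_root m x"
    "map_poly to_fract (carlitz_cyclotomic m) = min_poly x"
proof -
  define x where "x = (SOME x. primitive_carlitz_root m x)"
  define p where "p = min_poly x"
  have x: "primitive_carlitz_root m x"
    unfolding x_def using someI_ex[OF primitive_root_exists[OF assms(2)]] .
  have p: "is_min_poly x p"
    unfolding p_def by (rule is_min_poly_min_poly)
  have "poly (lift_ac (carlitz m)) x = 0"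
    using x by (simp add: primitive_carlitz_root_def carlitz_torsion_def carlitz_act_def)
  then have "p dvd map_poly to_fract (carlitz m)"
    unfolding poly_lift_ac by (rule min_poly_dvd[OF p])
  then obtain q where q: "map_poly to_fract (carlitz m) = p * q" by blast
  have "lead_coeff (map_poly to_fract (carlitz m)) = 1"
    using lead_coeff_carlitz[of m] assms(1) by (simp add: degree_map_poly coeff_map_poly flip: one_pCons)
  then have "lead_coeff q = 1"
    using p by (simp add: q lead_coeff_mult is_min_poly_def)
  then obtain P where P: "p = map_poly to_fract P"
    using monic_factor_integral[OF q[symmetric]] p by (auto simp: is_min_poly_def)
  have "carlitz_cyclotomic m = P"
    unfolding carlitz_cyclotomic_def x_def[symmetric] p_def[symmetric]
    by (rule the_equality) (simp_all add: P)
  then show ?thesis using that x P p_def by blast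
qed

text \<open>For monic \<open>P\<close>, pseudo-division is ordinary division with remainder, and the
  remainder keeps its degree over the fraction field.\<close>

lemma monic_dvd_of_fract_dvd:
  fixes P F :: "'b::idom poly"
  assumes "lead_coeff P = 1" "map_poly to_fract P dvd map_poly to_fract F"
  shows "P dvd F"
proof -
  have P0: "P \<noteq> 0" using assms(1) by auto
  obtain q r where qr: "pseudo_divmod F P = (q, r)" by (cases "pseudo_divmod F P")
  have F: "F = P * q + r" and r: "r = 0 \<or> degree r < degree P"
    using pseudo_divmod[OF P0 qr] assms(1) by simp_all
  have "map_poly to_fract P dvd map_poly to_fract r"
    using assms(2) unfolding F by (metis dvd_add_right_iff dvd_triv_left fract_poly_add fract_poly_mult)
  then have "r = 0 \<or> degree P \<le> degree r"
    using dvd_imp_degree_le[of "map_poly to_fract P" "map_poly to_fract r"]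
    by (auto simp: degree_map_poly)
  then have "r = 0" using r by auto
  then show ?thesis by (simp add: F)
qed

section \<open>Divisibility relations for cyclotomic values\<close>

lemma carlitz_cyclotomic_dvd:
  fixes m k n :: "'a::finite_field poly"
  assumes "lead_coeff m = 1" "degree m > 0" "m = k * n" "degree k > 0"
  shows "carlitz_cyclotomic m dvd pcompose (carlitz_red k) (carlitz n)"
proof -
  obtain x where x: "primitive_carlitz_root m x"
    "map_poly to_fract (carlitz_cyclotomic m) = min_poly x"
    using carlitz_cyclotomic_eq_min_poly[OF assms(1,2)] .
  have m0: "m \<noteq> 0" using assms by auto
  note ord = primitive_root_exact_order[OF m0 x(1)]
  have "\<not> m dvd n"
  proof
    assume "m dvd n"
    moreover have "n \<noteq> 0" "k \<noteq> 0" using m0 assms(3) by auto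
    ultimately have "degree m \<le> degree n" using dvd_imp_degree_le by blast
    then show False using assms(3,4) \<open>n \<noteq> 0\<close> \<open>k \<noteq> 0\<close> by (simp add: degree_mult_eq)
  qed
  then have "carlitz_act n x \<noteq> 0" by (simp add: ord)
  moreover have "carlitz_act n x * poly (lift_ac (carlitz_red k)) (carlitz_act n x) = 0"
    using ord[of m] assms(3) by (simp add: carlitz_act_mult flip: carlitz_act_eq_red)
  ultimately have "poly (lift_ac (pcompose (carlitz_red k) (carlitz n))) x = 0"
    by (simp add: lift_ac_pcompose poly_pcompose carlitz_act_def)
  then have dvd: "min_poly x dvd map_poly to_fract (pcompose (carlitz_red k) (carlitz n))"
    unfolding poly_lift_ac by (rule min_poly_dvd[OF is_min_poly_min_poly])
  \<comment> \<open>Monicity, inherited from the minimal polynomial, brings the divisibility down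
    from the fraction field to A.\<close>
  have "lead_coeff (map_poly to_fract (carlitz_cyclotomic m)) = 1"
    using is_min_poly_min_poly[of x] by (simp only: x(2) is_min_poly_def)
  then have "to_fract (lead_coeff (carlitz_cyclotomic m)) = to_fract 1"
    by (simp add: degree_map_poly coeff_map_poly)
  then have "lead_coeff (carlitz_cyclotomic m) = 1"
    by (simp only: to_fract_eq_iff)
  then show ?thesis
    by (rule monic_dvd_of_fract_dvd) (simp only: x(2) dvd)
qed

lemma carlitz_cyclotomic_eval_dvd:
  fixes m k n u :: "'a::finite_field poly"
  assumes "lead_coeff m = 1" "degree m > 0" "m = k * n" "degree k > 0"
  shows "poly (carlitz_cyclotomic m) u dvd poly (carlitz_red k) (poly (carlitz n) u)"
proof -
  obtain h where "pcompose (carlitz_red k) (carlitz n) = carlitz_cyclotomic m * h"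
    using carlitz_cyclotomic_dvd[OF assms] by blast
  then show ?thesis by (metis dvd_triv_left poly_mult poly_pcompose)
qed

text \<open>For y = C_n(u), a multiple of \<open>w\<close>, the value R_k(y) is congruent to R_k(0)
  = k modulo \<open>w\<close>, and Psi_m(u) divides R_k(y).\<close>

lemma dvd_cofactor:
  fixes m k n u w :: "'a::finite_field poly"
  assumes "lead_coeff m = 1" "degree m > 0" "m = k * n" "degree k > 0"
    and "w dvd poly (carlitz_cyclotomic m) u" "w dvd poly (carlitz n) u"
  shows "w dvd k"
proof -
  have "w dvd poly (carlitz_red k) (poly (carlitz n) u)"
    using carlitz_cyclotomic_eval_dvd[OF assms(1-4)] assms(5) dvd_trans by blast
  moreover have "w dvd poly (carlitz_red k) (poly (carlitz n) u) - k"
    using poly_carlitz_red_cong assms(6) dvd_trans by blast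
  ultimately show ?thesis by (metis diff_diff_eq2 add_diff_cancel_left' dvd_diff)
qed

text \<open>The case k = m, n = 1 gives R_m(u), a factor of C_m(u) = u R_m(u).\<close>

lemma carlitz_cyclotomic_eval_dvd_carlitz:
  fixes m u :: "'a::finite_field poly"
  assumes "lead_coeff m = 1" "degree m > 0"
  shows "poly (carlitz_cyclotomic m) u dvd poly (carlitz m) u"
  using carlitz_cyclotomic_eval_dvd[of m m 1 u] assms
  by (simp add: carlitz_1 carlitz_eval)

section \<open>Carlitz annihilators as ideal generators\<close>

lemma carlitz_mult_eval: "poly (carlitz (a * b)) u = poly (carlitz a) (poly (carlitz b) u)"
  by (simp add: carlitz_mult poly_pcompose)

lemma carlitz_diff_eval: "poly (carlitz (a - b)) u = poly (carlitz a) u - poly (carlitz b) u"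
  using carlitz_add[of "a - b" b] by (simp add: algebra_simps)

text \<open>The polynomials annihilating \<open>u\<close> modulo \<open>w\<close> form an ideal,
  nonzero because of \<open>m\<close>. The generator is not normalised; it is a unit when
  \<open>w\<close> divides \<open>u\<close>.\<close>

lemma annihilator_generator:
  fixes m u w :: "'a::finite_field poly"
  assumes "m \<noteq> 0" "w dvd poly (carlitz m) u"
  obtains P where "P \<noteq> 0" "\<And>n. w dvd poly (carlitz n) u \<longleftrightarrow> P dvd n"
proof -
  define I where "I = {n. w dvd poly (carlitz n) u}"
  have "\<exists>P. P \<noteq> 0 \<and> (\<forall>n. n \<in> I \<longleftrightarrow> P dvd n)"
  proof (rule poly_ideal_principal[of I m])
    show "f - g \<in> I" if "f \<in> I" "g \<in> I" for f g
      using that by (simp add: I_def carlitz_diff_eval)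
    show "g * f \<in> I" if "f \<in> I" for f g
      using that by (simp add: I_def carlitz_mult_eval dvd_carlitz)
  qed (use assms in \<open>auto simp: I_def\<close>)
  then show ?thesis using that by (auto simp: I_def)
qed

lemma monic_dvd_antisym:
  fixes P Q :: "'b::idom poly"
  assumes "lead_coeff P = 1" "lead_coeff Q = 1" "P dvd Q" "Q dvd P"
  shows "P = Q"
proof -
  have nz: "P \<noteq> 0" "Q \<noteq> 0" using assms(1,2) by auto
  obtain c where c: "Q = P * c" using assms(3) by blast
  have "c \<noteq> 0" using nz c by auto
  moreover have "degree Q \<le> degree P" using assms(4) nz(1) by (rule dvd_imp_degree_le)
  ultimately have "degree c = 0" using nz(1) by (simp add: c degree_mult_eq)
  then obtain e where e: "c = [:e:]" by (rule degree_eq_zeroE)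
  have "lead_coeff c = 1" using assms(1,2) by (simp add: c lead_coeff_mult)
  then show ?thesis using c e by simp
qed

text \<open>Covers both branches of the definition: if \<open>w\<close> divides \<open>u\<close>,
  the ideal contains 1 and its monic generator is 1.\<close>

lemma carlitz_annihilator_eqI:
  fixes P u w :: "'a::finite_field poly"
  assumes "lead_coeff P = 1" and P: "\<And>n. P dvd n \<longleftrightarrow> w dvd poly (carlitz n) u"
  shows "carlitz_annihilator u w = P"
proof (cases "w dvd u")
  case True
  then have "P dvd 1" by (simp add: P carlitz_1)
  then obtain c where "P = [:c:]" by (auto simp: is_unit_poly_iff)
  then have "P = 1"
    using assms(1) by simp
  then show ?thesis using True by (simp add: carlitz_annihilator_def)
next
  case False
  then have "\<not> P dvd 1" by (simp add: P carlitz_1)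
  then have deg: "degree P > 0"
    using assms(1) is_unit_iff_degree[of P] by (cases "P = 0") auto
  have "(THE Q. lead_coeff Q = 1 \<and> degree Q > 0 \<and>
      (\<forall>n. n \<noteq> 0 \<longrightarrow> (Q dvd n \<longleftrightarrow> w dvd poly (carlitz n) u))) = P"
  proof (rule the_equality)
    fix Q assume Q: "lead_coeff Q = 1 \<and> degree Q > 0 \<and>
      (\<forall>n. n \<noteq> 0 \<longrightarrow> (Q dvd n \<longleftrightarrow> w dvd poly (carlitz n) u))"
    then have "P dvd Q" "Q dvd P"
      using assms(1) P by (metis dvd_refl leading_coeff_0_iff zero_neq_one)+
    then show "Q = P"
      using Q assms(1) by (intro monic_dvd_antisym) simp_all
  qed (use assms deg in auto)
  then show ?thesis using False by (simp add: carlitz_annihilator_def)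
qed

lemma prime_power_decompose:
  fixes m w :: "'b::field poly"
  assumes "prime_elem w" "m \<noteq> 0"
  obtains s k where "m = k * w ^ s" "\<not> w dvd k"
proof -
  have "\<exists>s k. m = k * w ^ s \<and> \<not> w dvd k"
    using assms(2)
  proof (induction "degree m" arbitrary: m rule: less_induct)
    case less
    show ?case
    proof (cases "w dvd m")
      case False
      then show ?thesis by (intro exI[of _ 0] exI[of _ m]) simp
    next
      case True
      then obtain r where r: "m = r * w" by (metis dvdE mult.commute)
      then have "r \<noteq> 0" "w \<noteq> 0" using less.prems by auto
      then have "degree r < degree m"
        using degree_prime_elem_pos[OF assms(1)] by (simp add: r degree_mult_eq)
      then obtain s k where "r = k * w ^ s" "\<not> w dvd k"
        using less.hyps \<open>r \<noteq> 0\<close> by blast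
      then show ?thesis by (intro exI[of _ "Suc s"] exI[of _ k]) (simp add: r)
    qed
  qed
  then show ?thesis using that by blast
qed

lemma monic_prime_dvd_carlitz_power_iff:
  fixes w :: "'a::finite_field poly"
  assumes "monic_prime w"
  shows "w dvd poly (carlitz (k * w ^ s)) u \<longleftrightarrow> w dvd poly (carlitz k) u"
proof (induction s)
  case (Suc s)
  have "k * w ^ Suc s = w * (k * w ^ s)" by simp
  then show ?case
    using Suc.IH by (simp only: carlitz_mult_eval[of w] monic_prime_dvd_carlitz_iff[OF assms])
qed simp

section \<open>Zsigmondy primes and the prime divisors of \<open>m\<close>\<close>

theorem theorem3p7:
  fixes m u w :: "'a::finite_field poly"
  assumes "lead_coeff m = 1" and "lead_coeff u = 1"
    and "degree m > 0"
    and "degree u = 0 \<or> degree u = 1 \<Longrightarrow> CARD('a) > 2"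
    and "monic_prime w" and "w dvd poly (carlitz_cyclotomic m) u"
  shows "(non_zsigmondy_prime u m w \<longleftrightarrow> w dvd m) \<and>
    (non_zsigmondy_prime u m w \<longrightarrow>
      (\<exists>s>0. m = carlitz_annihilator u w * w ^ s) \<and>
      (\<not> (CARD('a) = 2 \<and> degree w = 1) \<longrightarrow> \<not> w ^ 2 dvd poly (carlitz_cyclotomic m) u))"
proof -
  have w: "prime_elem w" "lead_coeff w = 1"
    using assms(5) by (simp_all add: monic_prime_def)
  have m0: "m \<noteq> 0" using assms(3) by auto
  have Cm: "w dvd poly (carlitz m) u"
    using carlitz_cyclotomic_eval_dvd_carlitz[OF assms(1,3)] assms(6) dvd_trans by blast
  obtain P where P: "P \<noteq> 0" "\<And>n. w dvd poly (carlitz n) u \<longleftrightarrow> P dvd n"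
    using annihilator_generator[OF m0 Cm] by blast
  obtain s k where sk: "m = k * w ^ s" "\<not> w dvd k"
    using prime_power_decompose[OF w(1) m0] by blast
  have Ck: "w dvd poly (carlitz k) u"
    using Cm by (simp add: sk(1) monic_prime_dvd_carlitz_power_iff[OF assms(5)])
  have k0: "k \<noteq> 0" using m0 sk by auto
  have dvd: "w dvd m" if nz: "non_zsigmondy_prime u m w"
  proof -
    \<comment> \<open>As \<open>w\<close> divides C_m(u), only the minimality clause can fail, which
      supplies \<open>n\<close>. Then \<open>P\<close> has smaller degree than \<open>m\<close>, so
      its cofactor \<open>r\<close> is nonconstant.\<close>
    obtain n where n: "n \<noteq> 0" "degree n < degree m" "w dvd poly (carlitz n) u"
      using nz Cm assms(5) by (auto simp: non_zsigmondy_prime_def zsigmondy_prime_def)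
    obtain r where r: "m = r * P" using Cm P(2) by (metis dvdE mult.commute)
    have "degree P \<le> degree n"
      using n P(2) by (intro dvd_imp_degree_le) auto
    then have "degree r > 0"
      using n(2) r m0 by (cases "r = 0") (auto simp: degree_mult_eq P(1))
    then have "w dvd r"
      by (rule dvd_cofactor[OF assms(1,3) r _ assms(6)]) (simp add: P(2))
    then show ?thesis by (simp add: r)
  qed
  have s_pos: "s > 0" if "w dvd m"
    using that sk by (cases s) auto
  have non: "non_zsigmondy_prime u m w" if "w dvd m"
  proof -
    \<comment> \<open>Minimality fails at \<open>k\<close>, which annihilates \<open>u\<close>
      modulo \<open>w\<close> and has smaller degree than \<open>m\<close>.\<close>
    have "degree m = degree k + s * degree w"
      using k0 w(1) by (auto simp: sk(1) degree_mult_eq degree_power_eq)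
    then have "degree k < degree m"
      using s_pos[OF that] degree_prime_elem_pos[OF w(1)] by simp
    then show ?thesis
      using Ck k0 assms(5) by (auto simp: non_zsigmondy_prime_def zsigmondy_prime_def)
  qed
  have ann: "carlitz_annihilator u w = k"
  proof (rule carlitz_annihilator_eqI)
    show "lead_coeff k = 1"
      using assms(1) w(2) by (simp add: sk(1) lead_coeff_mult lead_coeff_power)
    obtain r where r: "k = r * P" using Ck P(2) by (metis dvdE mult.commute)
    have "degree r = 0"
    proof (rule ccontr)
      assume "degree r \<noteq> 0"
      then have deg: "degree r > 0" by simp
      \<comment> \<open>\<open>P * w ^ s\<close> annihilates \<open>u\<close> modulo
        \<open>w\<close>, so a nonconstant cofactor \<open>r\<close> would be a multiple of
        \<open>w\<close>, although \<open>r\<close> divides \<open>k\<close>.\<close>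
      have "m = r * (P * w ^ s)" by (simp add: sk(1) r mult.assoc)
      then have "w dvd r"
        by (rule dvd_cofactor[OF assms(1,3) _ _ assms(6)]) (simp_all add: P(2) deg)
      then show False using sk(2) by (simp add: r)
    qed
    then have "is_unit r" using k0 r by (auto simp: is_unit_iff_degree)
    then show "k dvd n \<longleftrightarrow> w dvd poly (carlitz n) u" for n
      by (simp add: r P(2) mult_unit_dvd_iff')
  qed
  have square: "\<not> w ^ 2 dvd poly (carlitz_cyclotomic m) u"
    if wm: "w dvd m" and "\<not> (CARD('a) = 2 \<and> degree w = 1)"
  proof
    assume sq: "w ^ 2 dvd poly (carlitz_cyclotomic m) u"
    \<comment> \<open>Split off a single factor \<open>w\<close>: Psi_m(u) divides R_w(y) for y =
      C_{k w^t}(u), and R_w(y) is congruent to \<open>w\<close> modulo w^2 because \<open>w\<close>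
      divides y.\<close>
    obtain t where t: "s = Suc t" using s_pos[OF wm] gr0_implies_Suc by blast
    let ?y = "poly (carlitz (k * w ^ t)) u"
    have "w dvd ?y"
      using Ck by (simp add: monic_prime_dvd_carlitz_power_iff[OF assms(5)])
    then have "w ^ 2 dvd poly (carlitz_red w) ?y - w"
      by (rule square_dvd_carlitz_red_diff[OF w(1) _ that(2)])
    moreover have "m = w * (k * w ^ t)" by (simp add: sk(1) t)
    then have "w ^ 2 dvd poly (carlitz_red w) ?y"
      by (rule dvd_trans[OF sq carlitz_cyclotomic_eval_dvd[OF assms(1,3) _ degree_prime_elem_pos[OF w(1)]]])
    ultimately have "w ^ 2 dvd w"
      by (metis add_diff_cancel_left' diff_diff_eq2 dvd_diff)
    then have "w * w dvd w * 1" by (simp add: power2_eq_square)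
    then have "w dvd 1" using w(1) by (metis dvd_mult_cancel_left prime_elem_def)
    then show False using w(1) by (simp add: prime_elem_def)
  qed
  show ?thesis
    using dvd non s_pos ann sk(1) square by blast
qed

end
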